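(* Let $T:[0,1]\to[0,1]$ be a map with a neutral fixed point at $0$ as described in the context, with parameters $\alpha\in(0,1)$, $x_0\in(0,1)$, $\beta>1$ and function $\delta_0$. Let $\Delta=[x_0,1]$, $|\Delta|=1-x_0$, let $\hat T$ be the induced map on $\Delta$, $\hat f$ its invariant density, $\hat f_m$ the invariant density of the discretized operator $\mathbb P_m=Q_m\circ\hat{\mathcal L}$, $f^*$ the $T$-invariant density and $f_m$ its approximation (all defined in the context). Let $\gamma<1$, $C_{LY}>0$ and $\hat C$ be constants, with $\hat C$ computable and independent of $m$, such that $1/|\hat T'|\le\gamma$, such that $V_\Delta\hat{\mathcal L}f\le\gamma V_\Delta f+C_{LY}\|f\|_{1,\Delta}$ for all $f\in BV(\Delta)$, and such that $\|\hat f-\hat f_m\|_\infty\le\hat C\frac{\ln m}{m}$ for any $m\in\mathbb N$. Then for any $x\in(0,1]$ and any $m\in\mathbb N$ $$|f^*(x)-f_m(x)|\le\frac{C^*}{x^{1+\alpha}}\,\frac{\ln m}{m},$$ where $$C^*=\hat C\left(1+\frac{x_0^{1+\alpha}}{\beta}+M(1+\alpha)\right)C_4,\qquad M=\frac{C_1^{1+\alpha}e^{2C_0C_1^{2\alpha}}}{\beta},$$ $$C_0=\frac{\alpha(1+\alpha)}{2}\left[1+2\delta_0(x_0)+\delta_0(x_0)^2\right],\qquad C_1=\left(2[2^{1/\alpha}-1]\right)^{1/\alpha},$$ $$C_4=1+C_3\left(\frac{C_{LY}}{1-\gamma}+\frac1{|\Delta|}\right),\qquad C_3=\frac1\beta+\frac{C_2}{\beta|\Delta|}\left(\alpha+\frac{2-\alpha}{1-\alpha}\right),$$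 $$C_2=\frac{1-x_0}{x_0^{1+\alpha}}\,2^{1+\frac1\alpha}\left[2^{\frac1\alpha}-1\right]^{1+\frac1\alpha}.$$
   Context: Let $\lambda$ be Lebesgue measure on $I=[0,1]$. The map $T:I\to I$. There are $\alpha\in(0,1)$, $x_0\in(0,1)$ and $\beta>1$ such that: $T(0)=0$; with $T_1=T|_{[0,x_0)}$ and $T_2=T|_{[x_0,1]}$, $T_1$ maps $[0,x_0)$ onto $[0,1)$ and $T_2$ maps $[x_0,1]$ onto $[0,1]$; $T_1$ (extended to $x_0$) is $C^1$ on $[0,x_0]$ and $C^2$ on $(0,x_0]$; $T_2$ is $C^2$ on $[x_0,1]$; $T'(0)=1$, $T'(x)>1$ for $x\in(0,x_0)$, and $|T'(x)|\ge\beta>1$ for $x\in(x_0,1)$; finally $$T_1(x)=x+x^{1+\alpha}+x^{1+\alpha}\delta_0(x),\qquad T_1'(x)=1+(1+\alpha)x^\alpha+x^\alpha\delta_1(x),$$ where $\delta_i(x)\to0$ as $x\to0$ for $i=0,1$, and $\delta_0'(x)\ge0$. Induced map. $\Delta=[x_0,1]$, $|\Delta|=1-x_0$, and $\hat\lambda=\lambda/|\Delta|$ is normalized Lebesgue measure on $\Delta$. For $n\ge0$ let $x_{n+1}=T_1^{-1}(x_n)$; $W_0=(x_0,1)$, $W_n=(x_n,x_{n-1})$ for $n\ge1$; $Z_n=T_2^{-1}(W_{n-1})$ for $n\ge1$. Define $\hat T(x)=T^n(x)$ for $x\in Z_n$; $\tau_{Z_n}=n$ is the first return time of $Z_n$ to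 $\Delta$. Its transfer operator is $\hat{\mathcal L}f(x)=\sum_{y\in\hat T^{-1}x}f(y)/|\hat T'(y)|$. $V_\Delta$ denotes total variation over $\Delta$, $\|\cdot\|_{1,\Delta}$ the $L^1$ norm on $\Delta$ with respect to $\lambda$, $BV(\Delta)$ the functions of bounded variation on $\Delta$, and $\|\cdot\|_\infty$ the sup norm on $\Delta$. Facts the source quotes as known: each $\hat T|_{Z_n}$ is monotone, $C^2$, extends to a $C^2$ function on $\overline{Z_n}$ and is onto $\Delta$ (up to endpoints); $\sup_n\sup_{x\in Z_n}|\hat T''(x)|/(\hat T'(x))^2<\infty$; there is $\gamma<1$ with $1/|\hat T'|\le\gamma$; $\hat T$ has a unique invariant density $\hat f$ with respect to $\hat\lambda$ ($\hat{\mathcal L}\hat f=\hat f$, $\hat f\ge0$, $\int_\Delta\hat f\,d\hat\lambda=1$), taken in its Lipschitz continuous version; constants $C_{LY}$ and $\hat C$ as in the claim are available from earlier results. Discretization. Let $c_i=x_0+i|\Delta|/m$, $i=0,\dots,m$, $I_i=[c_{i-1},c_i]$, and let $\psi_0,\dots,\psi_m$ be the hat functions: $\psi_i$ is continuous on $\Delta$, affine on each $I_j$, with $\psi_i(c_j)=1$ if $i=j$ and $0$ otherwise. For $f\in L^1(\Delta)$ put $f_i=\frac m{|\Delta|}\int_{I_i}f\,d\lambda$ and $$Q_mf=f_1\psi_0+\sum_{i=1}^{m-1}\frac{f_i+f_{i+1}}2\psi_i+f_m\psi_m .$$ Let $\mathbb P_m=Q_m\circ\hat{\mathcal L}$, and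 let $\hat f_m$ be its invariant density: $\hat f_m\ge0$, $\mathbb P_m\hat f_m=\hat f_m$, $\int_\Delta\hat f_m\,d\hat\lambda=1$. The functions on $I$. Let $\hat\mu=\hat f\cdot\hat\lambda$, $\hat\mu_m=\hat f_m\cdot\hat\lambda$, $c_\tau^{-1}=\sum_{k\ge1}\tau_{Z_k}\hat\mu(Z_k)$, $c_{\tau,m}^{-1}=\sum_{k\ge1}\tau_{Z_k}\hat\mu_m(Z_k)$. The unique $T$-invariant density $f^*$ is taken in the form and with the normalization given by $$f^*(x)=c_\tau\hat f(x)\ (x\in\Delta),\qquad f^*(x)=c_\tau\sum_{n=1}^\infty\frac{\hat f(T_2^{-1}T_1^{-(n-1)}x)}{|DT^{(n)}(T_2^{-1}T_1^{-(n-1)}x)|}\ (x\in I\setminus\Delta),$$ and $f_m$ is defined by $$f_m(x)=c_{\tau,m}\hat f_m(x)\ (x\in\Delta),\qquad f_m(x)=c_{\tau,m}\sum_{n=1}^\infty\frac{\hat f_m(T_2^{-1}T_1^{-(n-1)}x)}{|DT^{(n)}(T_2^{-1}T_1^{-(n-1)}x)|}\ (x\in I\setminus\Delta),$$ where $DT^{(n)}$ is the derivative of the $n$-th iterate $T^n$ (computed along the branches $T_1^{n-1}\circ T_2$). *)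

theory Defs
  imports "HOL-Analysis.Analysis"
begin

section \<open>Regularity and variation\<close>

text \<open>Derivatives are taken within the set, hence one-sided at endpoints belonging to it.\<close>

definition C1_on :: "real set \<Rightarrow> (real \<Rightarrow> real) \<Rightarrow> bool" where
  "C1_on S f \<longleftrightarrow>
     (\<exists>f'. (\<forall>x\<in>S. (f has_real_derivative f' x) (at x within S)) \<and> continuous_on S f')"

definition C2_on :: "real set \<Rightarrow> (real \<Rightarrow> real) \<Rightarrow> bool" where
  "C2_on S f \<longleftrightarrow>
     (\<exists>f'. (\<forall>x\<in>S. (f has_real_derivative f' x) (at x within S)) \<and> C1_on S f')"

definition total_variation :: "real set \<Rightarrow> (real \<Rightarrow> real) \<Rightarrow> ennreal" where
  "total_variation S f =
     (SUP xs\<in>{xs. sorted xs \<and> set xs \<subseteq> S}.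
        \<Sum>i<length xs - 1. ennreal \<bar>f (xs ! Suc i) - f (xs ! i)\<bar>)"

definition bounded_variation_on :: "real set \<Rightarrow> (real \<Rightarrow> real) \<Rightarrow> bool" where
  "bounded_variation_on S f \<longleftrightarrow> total_variation S f < \<infinity>"


section \<open>The map with a neutral fixed point\<close>

text \<open>
  The map \<open>T\<close> matters only on \<open>[0,1]\<close>. Its first branch is the restriction of \<open>T\<close> to
  \<open>[0,x0)\<close>, and \<open>T1\<close> is the extension of that branch to \<open>[0,x0]\<close>; its second branch is the
  restriction of \<open>T\<close> to \<open>[x0,1]\<close>, which may be increasing or decreasing.
\<close>

locale neutral_map =
  fixes T T1 :: "real \<Rightarrow> real" and \<alpha> x0 \<beta> :: real and \<delta>0 \<delta>1 :: "real \<Rightarrow> real"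
  assumes alpha: "0 < \<alpha>" "\<alpha> < 1"
    and x0: "0 < x0" "x0 < 1"
    and beta: "1 < \<beta>"
    and T_0: "T 0 = 0"
    and T1_eq: "\<And>x. x \<in> {0..<x0} \<Longrightarrow> T1 x = T x"
    and T1_onto: "T ` {0..<x0} = {0..<1}"
    and T2_onto: "T ` {x0..1} = {0..1}"
    and T1_C1: "C1_on {0..x0} T1"
    and T1_C2: "C2_on {0<..x0} T1"
    and T2_C2: "C2_on {x0..1} T"
    and T_deriv_0: "(T has_real_derivative 1) (at 0 within {0..1})"
    and T_deriv_left: "\<And>x. x \<in> {0<..<x0} \<Longrightarrow> deriv T x > 1"
    and T_deriv_right: "\<And>x. x \<in> {x0<..<1} \<Longrightarrow> \<bar>deriv T x\<bar> \<ge> \<beta>"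
    and T1_expansion:
      "\<And>x. x \<in> {0<..x0} \<Longrightarrow> T1 x = x + x powr (1 + \<alpha>) + x powr (1 + \<alpha>) * \<delta>0 x"
    and T1_deriv_expansion:
      "\<And>x. x \<in> {0<..x0} \<Longrightarrow>
         (T1 has_real_derivative (1 + (1 + \<alpha>) * x powr \<alpha> + x powr \<alpha> * \<delta>1 x))
           (at x within {0..x0})"
    and delta0_lim: "(\<delta>0 \<longlongrightarrow> 0) (at_right 0)"
    and delta1_lim: "(\<delta>1 \<longlongrightarrow> 0) (at_right 0)"
    and delta0_deriv: "\<And>x. x \<in> {0<..<x0} \<Longrightarrow> deriv \<delta>0 x \<ge> 0"


section \<open>The induced map and its transfer operator\<close>

definition inv_branch1 :: "(real \<Rightarrow> real) \<Rightarrow> real \<Rightarrow> real \<Rightarrow> real" where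
  "inv_branch1 T x0 = inv_into {0..<x0} T"

definition inv_branch2 :: "(real \<Rightarrow> real) \<Rightarrow> real \<Rightarrow> real \<Rightarrow> real" where
  "inv_branch2 T x0 = inv_into {x0..1} T"

definition cut :: "(real \<Rightarrow> real) \<Rightarrow> real \<Rightarrow> nat \<Rightarrow> real" where
  "cut T x0 n = (inv_branch1 T x0 ^^ n) x0"

definition W :: "(real \<Rightarrow> real) \<Rightarrow> real \<Rightarrow> nat \<Rightarrow> real set" where
  "W T x0 n = (if n = 0 then {x0<..<1} else {cut T x0 n<..<cut T x0 (n - 1)})"

text \<open>Only the indices \<open>n \<ge> 1\<close> of \<open>Z\<close> are meaningful.\<close>

definition Z :: "(real \<Rightarrow> real) \<Rightarrow> real \<Rightarrow> nat \<Rightarrow> real set" where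
  "Z T x0 n = {x \<in> {x0..1}. T x \<in> W T x0 (n - 1)}"

definition induced_dom :: "(real \<Rightarrow> real) \<Rightarrow> real \<Rightarrow> real set" where
  "induced_dom T x0 = (\<Union>n\<in>{1..}. Z T x0 n)"

text \<open>The induced map is meaningful only on \<open>induced_dom\<close>, an open subset of \<open>[x0,1]\<close> with
  countable complement there.\<close>

definition induced_map :: "(real \<Rightarrow> real) \<Rightarrow> real \<Rightarrow> real \<Rightarrow> real" where
  "induced_map T x0 x = (T ^^ (THE n. 1 \<le> n \<and> x \<in> Z T x0 n)) x"

definition transfer_op ::
  "(real \<Rightarrow> real) \<Rightarrow> real \<Rightarrow> (real \<Rightarrow> real) \<Rightarrow> real \<Rightarrow> real" where
  "transfer_op T x0 f x =
     (\<Sum>\<^sub>\<infinity>y\<in>{y \<in> induced_dom T x0. induced_map T x0 y = x}. f y / \<bar>deriv (induced_map T x0) y\<bar>)"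

definition lambda_hat :: "real \<Rightarrow> real measure" where
  "lambda_hat x0 = uniform_measure lebesgue {x0..1}"

definition L1_norm :: "real \<Rightarrow> (real \<Rightarrow> real) \<Rightarrow> real" where
  "L1_norm x0 f = (LINT x:{x0..1}|lebesgue. \<bar>f x\<bar>)"

definition sup_norm :: "real \<Rightarrow> (real \<Rightarrow> real) \<Rightarrow> real" where
  "sup_norm x0 f = (SUP x\<in>{x0..1}. \<bar>f x\<bar>)"

definition is_density :: "real \<Rightarrow> (real \<Rightarrow> real) \<Rightarrow> bool" where
  "is_density x0 f \<longleftrightarrow>
     (\<forall>x\<in>{x0..1}. 0 \<le> f x) \<and> (LINT x:{x0..1}|lambda_hat x0. f x) = 1"

text \<open>The Lipschitz version of the invariant density of the induced map. The equation can only
  hold almost everywhere as it stands: the points \<open>x0\<close> and \<open>1\<close> have no preimage in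
  \<open>induced_dom\<close>.\<close>

definition induced_inv_density ::
  "(real \<Rightarrow> real) \<Rightarrow> real \<Rightarrow> (real \<Rightarrow> real) \<Rightarrow> bool" where
  "induced_inv_density T x0 f \<longleftrightarrow>
     is_density x0 f \<and> (\<exists>L. L-lipschitz_on {x0..1} f) \<and>
     (AE x in lambda_hat x0. transfer_op T x0 f x = f x)"

text \<open>The left-hand variation is over the open interval because the formula for the transfer
  operator determines no values at the endpoints of \<open>[x0,1]\<close>, which have no preimages in
  \<open>induced_dom\<close>.\<close>

definition lasota_yorke ::
  "(real \<Rightarrow> real) \<Rightarrow> real \<Rightarrow> real \<Rightarrow> real \<Rightarrow> bool" where
  "lasota_yorke T x0 \<gamma> C \<longleftrightarrow>
     (\<forall>f. bounded_variation_on {x0..1} f \<longrightarrow>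
        total_variation {x0<..<1} (transfer_op T x0 f)
          \<le> ennreal \<gamma> * total_variation {x0..1} f + ennreal (C * L1_norm x0 f))"


section \<open>The discretized operator\<close>

definition node :: "real \<Rightarrow> nat \<Rightarrow> nat \<Rightarrow> real" where
  "node x0 m i = x0 + real i * (1 - x0) / real m"

definition cell :: "real \<Rightarrow> nat \<Rightarrow> nat \<Rightarrow> real set" where
  "cell x0 m i = {node x0 m (i - 1)..node x0 m i}"

text \<open>Closed form of the hat function; the three lemmas below are its defining properties.\<close>

definition hat :: "real \<Rightarrow> nat \<Rightarrow> nat \<Rightarrow> real \<Rightarrow> real" where
  "hat x0 m i x = max 0 (1 - real m / (1 - x0) * \<bar>x - node x0 m i\<bar>)"

lemma continuous_on_hat: "continuous_on {x0..1} (hat x0 m i)"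
  unfolding hat_def by (intro continuous_intros)

lemma hat_node:
  assumes "x0 < 1" "1 \<le> m"
  shows "hat x0 m i (node x0 m j) = (if i = j then 1 else 0)"
proof -
  have "real m / (1 - x0) * \<bar>node x0 m j - node x0 m i\<bar> = \<bar>real j - real i\<bar>"
  proof -
    have "node x0 m j - node x0 m i = (real j - real i) * ((1 - x0) / real m)"
      using assms by (simp add: node_def field_simps)
    then have "\<bar>node x0 m j - node x0 m i\<bar> = \<bar>real j - real i\<bar> * ((1 - x0) / real m)"
      using assms by (simp add: abs_mult)
    then show ?thesis using assms by simp
  qed
  moreover have "1 \<le> \<bar>real j - real i\<bar>" if "i \<noteq> j"
    using that by linarith
  ultimately show ?thesis
    by (auto simp: hat_def)
qed

lemma hat_affine:
  assumes "x0 < 1" "1 \<le> m" "1 \<le> j"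
  shows "\<exists>a b. \<forall>x\<in>cell x0 m j. hat x0 m i x = a * x + b"
proof -
  define h where "h = (1 - x0) / real m"
  have h: "0 < h" "real m / (1 - x0) = 1 / h"
    using assms by (auto simp: h_def)
  have n: "node x0 m k = x0 + real k * h" for k
    by (simp add: node_def h_def)
  have hat: "hat x0 m i x = max 0 (1 - \<bar>x - (x0 + real i * h)\<bar> / h)" for x
    by (simp add: hat_def h n)
  have j: "real (j - 1) = real j - 1"
    using assms by (simp add: of_nat_diff)
  consider "i = j" | "i = j - 1" | "i + 1 \<le> j - 1" | "j + 1 \<le> i"
    by linarith
  then show ?thesis
  proof cases
    case 1
    have "hat x0 m i x = (1 / h) * x + (1 - (x0 + real i * h) / h)" if "x \<in> cell x0 m j" for x
      using that h(1) unfolding hat unfolding cell_def n j 1 by (auto simp: field_simps max_def abs_if)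
    then show ?thesis by blast
  next
    case 2
    have "hat x0 m i x = (- 1 / h) * x + (1 + (x0 + real i * h) / h)" if "x \<in> cell x0 m j" for x
      using that h(1) unfolding hat unfolding cell_def n 2 j by (auto simp: field_simps max_def abs_if)
    then show ?thesis by blast
  next
    case 3
    have "hat x0 m i x = 0 * x + 0" if "x \<in> cell x0 m j" for x
    proof -
      have "x0 + (real i + 1) * h \<le> x0 + real (j - 1) * h"
        using 3 h(1) by (intro add_left_mono mult_right_mono) auto
      then have "h \<le> \<bar>x - (x0 + real i * h)\<bar>"
        using that unfolding cell_def n by (auto simp: algebra_simps)
      then show ?thesis
        using h(1) by (simp add: hat)
    qed
    then show ?thesis by blast
  next
    case 4
    have "hat x0 m i x = 0 * x + 0" if "x \<in> cell x0 m j" for x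
    proof -
      have "x0 + (real j + 1) * h \<le> x0 + real i * h"
        using 4 h(1) by (intro add_left_mono mult_right_mono) auto
      then have "h \<le> \<bar>x - (x0 + real i * h)\<bar>"
        using that unfolding cell_def n by (auto simp: algebra_simps)
      then show ?thesis
        using h(1) by (simp add: hat)
    qed
    then show ?thesis by blast
  qed
qed

definition cell_avg :: "real \<Rightarrow> nat \<Rightarrow> (real \<Rightarrow> real) \<Rightarrow> nat \<Rightarrow> real" where
  "cell_avg x0 m f i = real m / (1 - x0) * (LINT x:cell x0 m i|lebesgue. f x)"

definition Q :: "real \<Rightarrow> nat \<Rightarrow> (real \<Rightarrow> real) \<Rightarrow> real \<Rightarrow> real" where
  "Q x0 m f x =
     cell_avg x0 m f 1 * hat x0 m 0 x
     + (\<Sum>i = 1..m - 1. (cell_avg x0 m f i + cell_avg x0 m f (i + 1)) / 2 * hat x0 m i x)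
     + cell_avg x0 m f m * hat x0 m m x"

definition discr_op ::
  "(real \<Rightarrow> real) \<Rightarrow> real \<Rightarrow> nat \<Rightarrow> (real \<Rightarrow> real) \<Rightarrow> real \<Rightarrow> real" where
  "discr_op T x0 m f = Q x0 m (transfer_op T x0 f)"

definition discr_inv_density ::
  "(real \<Rightarrow> real) \<Rightarrow> real \<Rightarrow> nat \<Rightarrow> (real \<Rightarrow> real) \<Rightarrow> bool" where
  "discr_inv_density T x0 m f \<longleftrightarrow>
     is_density x0 f \<and> (\<forall>x\<in>{x0..1}. discr_op T x0 m f x = f x)"


section \<open>Densities on the whole interval\<close>

text \<open>The measure \<open>(g \<cdot> lambda_hat)(A)\<close>.\<close>

definition density_mass :: "real \<Rightarrow> (real \<Rightarrow> real) \<Rightarrow> real set \<Rightarrow> real" where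
  "density_mass x0 g A = (LINT x:A|lambda_hat x0. g x)"

definition c_tau :: "(real \<Rightarrow> real) \<Rightarrow> real \<Rightarrow> (real \<Rightarrow> real) \<Rightarrow> real" where
  "c_tau T x0 g = inverse (\<Sum>k. real (Suc k) * density_mass x0 g (Z T x0 (Suc k)))"

text \<open>The series is shifted: the term with index \<open>n\<close> belongs to the iterate \<open>n + 1\<close> of \<open>T\<close>.
  For \<open>x\<close> in \<open>(0,x0)\<close> the points \<open>y\<close> lie in the interior of the domain of a smooth branch of
  that iterate.\<close>

definition extend_density ::
  "(real \<Rightarrow> real) \<Rightarrow> real \<Rightarrow> (real \<Rightarrow> real) \<Rightarrow> real \<Rightarrow> real" where
  "extend_density T x0 g x =
     (if x \<in> {x0..1} then c_tau T x0 g * g x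
      else c_tau T x0 g *
        (\<Sum>n. let y = inv_branch2 T x0 ((inv_branch1 T x0 ^^ n) x)
              in g y / \<bar>deriv (T ^^ Suc n) y\<bar>))"


section \<open>The constants\<close>

definition C0 :: "real \<Rightarrow> real \<Rightarrow> (real \<Rightarrow> real) \<Rightarrow> real" where
  "C0 \<alpha> x0 \<delta>0 = \<alpha> * (1 + \<alpha>) / 2 * (1 + 2 * \<delta>0 x0 + (\<delta>0 x0)\<^sup>2)"

definition C1 :: "real \<Rightarrow> real" where
  "C1 \<alpha> = (2 * (2 powr (1 / \<alpha>) - 1)) powr (1 / \<alpha>)"

definition C2 :: "real \<Rightarrow> real \<Rightarrow> real" where
  "C2 \<alpha> x0 = (1 - x0) / x0 powr (1 + \<alpha>) * 2 powr (1 + 1 / \<alpha>)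
     * (2 powr (1 / \<alpha>) - 1) powr (1 + 1 / \<alpha>)"

definition C3 :: "real \<Rightarrow> real \<Rightarrow> real \<Rightarrow> real" where
  "C3 \<alpha> x0 \<beta> = 1 / \<beta> + C2 \<alpha> x0 / (\<beta> * (1 - x0)) * (\<alpha> + (2 - \<alpha>) / (1 - \<alpha>))"

definition C4 :: "real \<Rightarrow> real \<Rightarrow> real \<Rightarrow> real \<Rightarrow> real \<Rightarrow> real" where
  "C4 \<alpha> x0 \<beta> \<gamma> C_LY = 1 + C3 \<alpha> x0 \<beta> * (C_LY / (1 - \<gamma>) + 1 / (1 - x0))"

definition M_const :: "real \<Rightarrow> real \<Rightarrow> real \<Rightarrow> (real \<Rightarrow> real) \<Rightarrow> real" where
  "M_const \<alpha> x0 \<beta> \<delta>0 =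
     C1 \<alpha> powr (1 + \<alpha>) * exp (2 * C0 \<alpha> x0 \<delta>0 * C1 \<alpha> powr (2 * \<alpha>)) / \<beta>"

definition C_star ::
  "real \<Rightarrow> real \<Rightarrow> real \<Rightarrow> (real \<Rightarrow> real) \<Rightarrow> real \<Rightarrow> real \<Rightarrow> real \<Rightarrow> real" where
  "C_star \<alpha> x0 \<beta> \<delta>0 \<gamma> C_LY C_hat =
     C_hat * (1 + x0 powr (1 + \<alpha>) / \<beta> + M_const \<alpha> x0 \<beta> \<delta>0 * (1 + \<alpha>)) * C4 \<alpha> x0 \<beta> \<gamma> C_LY"

end

theory Submission
  imports Defs
begin

text \<open>
  On \<open>[x0,1]\<close> the two normalized densities differ by
  \<open>c' (f - f') + (c - c') f\<close>. Here \<open>c, c' \<le> 1\<close> because every return time is at least 1,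
  \<open>\<bar>c - c'\<bar>\<close> is at most \<open>\<Sum>k \<lambda>(Z k)\<close> times the sup distance, and \<open>f\<close> is bounded by its mean plus
  its variation, which the Lasota-Yorke inequality controls. The sum \<open>\<Sum>k \<lambda>(Z k)\<close> and the weights
  \<open>1 / \<bar>DT^n\<bar>\<close> in the series off \<open>[x0,1]\<close> are both summable because the backward orbits of the
  first branch decay like \<open>n powr (-1/\<alpha>)\<close>. Up to a factor with a convergent infinite product,
  \<open>1/T'(x)\<close> is at most \<open>(x / T x) powr (1 + \<alpha>)\<close>, so the weights telescope along such an orbit.
\<close>

section \<open>Power estimates\<close>

text \<open>Near the neutral point the derivative of \<open>T\<close> tends to 1, so no geometric
  decay of the weights is available and polynomial decay has to replace it. Put
  \<open>u = x powr \<alpha> * (1 + \<delta>0 x)\<close>. Then \<open>T x = x * (1 + u)\<close>,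
  while the sign of the derivative of \<delta>0 turns into
  \<open>1 + (1 + \<alpha>) * u \<le> deriv T x\<close>. Hence \<open>deriv T x\<close> dominates
  \<open>(T x / x) powr (1 + \<alpha>)\<close> to first order in \<open>u\<close>, and only a term
  of size \<open>x powr (2 * \<alpha>)\<close> is lost. Along a backward orbit this term decays like
  the inverse square of the index, which is why the lost factors have a finite product.
  \<open>C0\<close> is the second-order Taylor coefficient times the square of
  \<open>1 + \<delta>0 x0\<close>; the factor 2 in the exponent of \<open>M_const\<close> bounds the
  sum of inverse squares. A second obstacle is that the invariance of the induced density holds only
  almost everywhere, while the Lasota-Yorke inequality concerns pointwise variation.\<close>

lemma powr_Suc_le_diff:
  fixes s :: real
  assumes "0 < s" "1 \<le> n"
  shows "s * real (Suc n) powr - (1 + s) \<le> real n powr - s - real (Suc n) powr - s"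
proof -
  have "((\<lambda>x. - (x powr - s)) has_real_derivative s * x powr - (1 + s)) (at x)" if "real n \<le> x" for x
  proof -
    have "((\<lambda>x. - (x powr - s)) has_real_derivative s * x powr (- s - 1)) (at x)"
      using that assms by (auto intro!: derivative_eq_intros)
    moreover have "- s - 1 = - (1 + s)" by simp
    ultimately show ?thesis by metis
  qed
  from MVT2[of "real n" "real (Suc n)", OF _ this]
  obtain \<xi> where \<xi>: "real n < \<xi>" "\<xi> < real (Suc n)"
    "real n powr - s - real (Suc n) powr - s = s * \<xi> powr - (1 + s)"
    by (auto simp: algebra_simps)
  moreover have "real (Suc n) powr - (1 + s) \<le> \<xi> powr - (1 + s)"
    using \<xi> assms by (intro powr_mono2') auto
  ultimately show ?thesis
    using assms by simp
qed

text \<open>Integral comparison in telescoped form. The term \<open>real n powr - s / s\<close> is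
  kept because the induction closes only with it; at \<open>n = 0\<close> it vanishes by the
  convention \<open>0 powr a = 0\<close>, so the first summand is checked separately.\<close>

lemma sum_powr_le:
  fixes s :: real
  assumes "0 < s"
  shows "(\<Sum>k<n. real (Suc k) powr - (1 + s)) \<le> 1 + 1 / s - real n powr - s / s"
proof (induction n)
  case 0
  then show ?case using assms by simp
next
  case (Suc n)
  show ?case
  proof (cases "n = 0")
    case False
    then have "real (Suc n) powr - (1 + s) \<le> (real n powr - s - real (Suc n) powr - s) / s"
      using powr_Suc_le_diff[OF assms, of n] assms by (simp add: pos_le_divide_eq mult.commute)
    then show ?thesis
      using Suc by (simp add: diff_divide_distrib)
  qed simp
qed

lemma
  fixes s :: real
  assumes "0 < s"
  shows summable_powr_Suc: "summable (\<lambda>k. real (Suc k) powr - (1 + s))"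
    and suminf_powr_Suc_le: "(\<Sum>k. real (Suc k) powr - (1 + s)) \<le> 1 + 1 / s"
    and sum_powr_Suc_le: "(\<Sum>k<n. real (Suc k) powr - (1 + s)) \<le> 1 + 1 / s"
proof -
  show *: "(\<Sum>k<n. real (Suc k) powr - (1 + s)) \<le> 1 + 1 / s" for n
    by (rule order_trans[OF sum_powr_le[OF assms]]) (use assms in simp)
  show "summable (\<lambda>k. real (Suc k) powr - (1 + s))"
    by (rule summableI_nonneg_bounded[OF _ *]) simp
  then show "(\<Sum>k. real (Suc k) powr - (1 + s)) \<le> 1 + 1 / s"
    by (rule suminf_le_const) (rule *)
qed

section \<open>Taylor and convexity bounds for real powers\<close>

lemma one_plus_powr_le_linear:
  fixes u :: real
  assumes "0 < \<alpha>" "\<alpha> < 1" "0 \<le> u"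
  shows "(1 + u) powr \<alpha> \<le> 1 + \<alpha> * u"
proof -
  have "1 + \<alpha> * 0 - (1 + 0) powr \<alpha> \<le> 1 + \<alpha> * u - (1 + u) powr \<alpha>"
  proof (rule DERIV_nonneg_imp_nondecreasing[OF \<open>0 \<le> u\<close>], intro exI conjI)
    fix v :: real assume v: "0 \<le> v"
    show "((\<lambda>v. 1 + \<alpha> * v - (1 + v) powr \<alpha>) has_real_derivative \<alpha> * (1 - (1 + v) powr (\<alpha> - 1))) (at v)"
      using v by (auto intro!: derivative_eq_intros simp: algebra_simps)
    have "(1 + v) powr (\<alpha> - 1) \<le> 1 powr (\<alpha> - 1)"
      using v assms by (intro powr_mono2') auto
    then show "0 \<le> \<alpha> * (1 - (1 + v) powr (\<alpha> - 1))"
      using assms by simp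
  qed
  then show ?thesis by simp
qed

text \<open>The derivative of the difference is \<open>1 + \<alpha>\<close> times the gap in the
  linear bound for the exponent \<alpha>, so this is that bound integrated once. Its quadratic
  coefficient is the leading factor of \<open>C0\<close>.\<close>

lemma one_plus_powr_le_quadratic:
  fixes u :: real
  assumes "0 < \<alpha>" "\<alpha> < 1" "0 \<le> u"
  shows "(1 + u) powr (1 + \<alpha>) \<le> 1 + (1 + \<alpha>) * u + \<alpha> * (1 + \<alpha>) / 2 * u\<^sup>2"
proof -
  let ?f = "\<lambda>u. 1 + (1 + \<alpha>) * u + \<alpha> * (1 + \<alpha>) / 2 * u\<^sup>2 - (1 + u) powr (1 + \<alpha>)"
  have "?f 0 \<le> ?f u"
  proof (rule DERIV_nonneg_imp_nondecreasing[OF \<open>0 \<le> u\<close>], intro exI conjI)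
    fix v :: real assume v: "0 \<le> v"
    show "(?f has_real_derivative (1 + \<alpha>) * (1 + \<alpha> * v - (1 + v) powr \<alpha>)) (at v)"
      using v by (auto intro!: derivative_eq_intros simp: algebra_simps)
    show "0 \<le> (1 + \<alpha>) * (1 + \<alpha> * v - (1 + v) powr \<alpha>)"
      using one_plus_powr_le_linear[OF assms(1,2) v] assms by simp
  qed
  then show ?thesis by simp
qed

text \<open>A convex function lies below its chord; over [0,1/2] the chord of
  \<open>(1 - t) powr - p\<close> has slope \<open>2 * (2 powr p - 1)\<close>.\<close>

lemma one_minus_powr_le:
  fixes p t :: real
  assumes "0 < p" "0 \<le> t" "t \<le> 1 / 2"
  shows "(1 - t) powr - p \<le> 1 + 2 * t * (2 powr p - 1)"
proof -
  have "convex_on {0..1/2} (\<lambda>t::real. (1 - t) powr - p)"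
  proof (rule f''_ge0_imp_convex)
    fix x :: real assume x: "x \<in> {0..1/2}"
    show "((\<lambda>t. (1 - t) powr - p) has_real_derivative p * (1 - x) powr (- p - 1)) (at x)"
      using x by (auto intro!: derivative_eq_intros)
    show "((\<lambda>x. p * (1 - x) powr (- p - 1)) has_real_derivative p * ((p + 1) * (1 - x) powr (- p - 2))) (at x)"
      using x by (auto intro!: derivative_eq_intros simp: algebra_simps)
    show "0 \<le> p * ((p + 1) * (1 - x) powr (- p - 2))"
      using assms by simp
  qed simp
  from convex_onD_Icc'[OF this, of t]
  have "(1 - t) powr - p \<le> ((1 / 2) powr - p - 1) * 2 * t + 1"
    using assms by simp
  also have "(1 / 2) powr - p = 2 powr p"
    by (simp add: powr_minus powr_divide)
  finally show ?thesis by (simp add: algebra_simps)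
qed

lemma C1_ge_1:
  assumes "0 < \<alpha>" "\<alpha> < 1"
  shows "1 \<le> C1 \<alpha>" "C1 \<alpha> powr \<alpha> = 2 * (2 powr (1 / \<alpha>) - 1)"
proof -
  have "2 powr 1 \<le> (2::real) powr (1 / \<alpha>)"
    using assms by (intro powr_mono) auto
  then have *: "2 \<le> 2 * ((2::real) powr (1 / \<alpha>) - 1)" by simp
  then show "C1 \<alpha> powr \<alpha> = 2 * (2 powr (1 / \<alpha>) - 1)"
    using assms by (simp add: C1_def powr_powr)
  show "1 \<le> C1 \<alpha>"
    unfolding C1_def using * assms by (intro ge_one_powr_ge_zero) auto
qed

text \<open>The constant \<open>C1\<close> is exactly what the chord bound \<open>one_minus_powr_le\<close> on
  \<open>[0,1/2]\<close> requires in the induction step, with \<open>t = 1/n\<close>.\<close>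

lemma powr_decay:
  fixes z :: "nat \<Rightarrow> real"
  assumes \<alpha>: "0 < \<alpha>" "\<alpha> < 1"
    and z0: "z 0 \<le> 1"
    and step: "\<And>k. z (Suc k) + z (Suc k) powr (1 + \<alpha>) \<le> z k"
  shows "z (Suc k) \<le> C1 \<alpha> * real (Suc k) powr - (1 / \<alpha>)"
proof (induction k)
  case 0
  have "z (Suc 0) \<le> 1"
    using step[of 0] z0 powr_ge_zero[of "z (Suc 0)" "1 + \<alpha>"] by linarith
  then show ?case using C1_ge_1[OF \<alpha>] by simp
next
  case (Suc k)
  let ?n = "real (Suc (Suc k))"
  define b where "b = C1 \<alpha> * ?n powr - (1 / \<alpha>)"
  have C1: "0 < C1 \<alpha>" using C1_ge_1[OF \<alpha>] by simp
  have b: "0 < b" unfolding b_def using C1 by simp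
  have b\<alpha>: "b powr \<alpha> = 2 * (2 powr (1 / \<alpha>) - 1) / ?n"
  proof -
    have "b powr \<alpha> = C1 \<alpha> powr \<alpha> * ?n powr - 1"
      using C1 \<alpha> unfolding b_def by (subst powr_mult) (simp_all add: powr_powr)
    then show ?thesis
      by (simp add: C1_ge_1(2)[OF \<alpha>] powr_minus_divide)
  qed
  have "z (Suc (Suc k)) \<le> b"
  proof (rule ccontr)
    assume "\<not> z (Suc (Suc k)) \<le> b"
    \<comment> \<open>Adding the power is strictly increasing on the positive reals, so a point
      above \<open>b\<close> forces its predecessor above \<open>b + b powr (1 + \<alpha>)\<close>.
      The induction hypothesis bounds the predecessor by exactly this value.\<close>
    then have "b + b powr (1 + \<alpha>) < z (Suc (Suc k)) + z (Suc (Suc k)) powr (1 + \<alpha>)"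
      using b \<alpha> by (intro add_strict_mono powr_less_mono2) auto
    also have "\<dots> \<le> C1 \<alpha> * real (Suc k) powr - (1 / \<alpha>)"
      using step[of "Suc k"] Suc by linarith
    also have "real (Suc k) = ?n * (1 - 1 / ?n)"
      by (simp add: field_simps)
    also have "C1 \<alpha> * (?n * (1 - 1 / ?n)) powr - (1 / \<alpha>) = b * (1 - 1 / ?n) powr - (1 / \<alpha>)"
      by (subst powr_mult) (auto simp: b_def)
    \<comment> \<open>Here \<open>?n\<close> is at least 2, so \<open>1 / ?n\<close> lies in
      [0,1/2]; this is why the decay bound starts at index 1.\<close>
    also have "\<dots> \<le> b * (1 + 2 * (1 / ?n) * (2 powr (1 / \<alpha>) - 1))"
      using b \<alpha> by (intro mult_left_mono one_minus_powr_le) (auto simp: field_simps)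
    also have "\<dots> = b + b * b powr \<alpha>"
      by (simp add: b\<alpha> algebra_simps)
    also have "\<dots> = b + b powr (1 + \<alpha>)"
      using b by (simp add: powr_add)
    finally show False by simp
  qed
  then show ?case by (simp add: b_def)
qed

section \<open>The neutral branch and its backward orbits\<close>

context neutral_map
begin

text \<open>A bound on \<open>deriv T x\<close> alone carries no differentiability. It is supplied
  by the expansion of the derivative of \<open>T1\<close>, transferred to \<open>T\<close> on the
  open interval where both agree.\<close>

lemma T_DERIV_left:
  assumes "x \<in> {0<..<x0}"
  shows "(T has_real_derivative deriv T x) (at x)"
proof -
  obtain D where "(T1 has_real_derivative D) (at x within {0..x0})"
    using T1_deriv_expansion[of x] assms by auto
  then have "(T1 has_real_derivative D) (at x)"
    using assms by (simp add: at_within_Icc_at)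
  then have "(T has_real_derivative D) (at x)"
    by (rule has_field_derivative_transform_within_open[where S="{0<..<x0}"])
       (use assms T1_eq in auto)
  then show ?thesis
    by (simp add: DERIV_imp_deriv)
qed

lemma continuous_on_T1: "continuous_on {0..x0} T1"
  using T1_C1 unfolding C1_on_def by (meson DERIV_continuous_on)

lemma T_DERIV_right:
  assumes "x \<in> {x0<..<1}"
  shows "(T has_real_derivative deriv T x) (at x)"
proof -
  obtain D where "(T has_real_derivative D) (at x within {x0..1})"
    using T2_C2 assms unfolding C2_on_def by fastforce
  then have "(T has_real_derivative D) (at x)"
    using assms by (simp add: at_within_Icc_at)
  then show ?thesis
    by (simp add: DERIV_imp_deriv)
qed

lemma continuous_on_T2: "continuous_on {x0..1} T"
  using T2_C2 unfolding C2_on_def by (meson DERIV_continuous_on)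

lemma T1_less:
  assumes "0 \<le> a" "a < b" "b \<le> x0"
  shows "T1 a < T1 b"
proof (rule DERIV_pos_imp_increasing_open[OF \<open>a < b\<close>])
  fix x assume x: "a < x" "x < b"
  have "(T1 has_real_derivative deriv T x) (at x)"
    using T_DERIV_left[of x]
    by (rule has_field_derivative_transform_within_open[where S="{0<..<x0}"])
       (use x assms T1_eq in auto)
  moreover have "0 < deriv T x"
    using T_deriv_left[of x] x assms by auto
  ultimately show "\<exists>y. (T1 has_real_derivative y) (at x) \<and> 0 < y" by blast
next
  show "continuous_on {a..b} T1"
    by (rule continuous_on_subset[OF continuous_on_T1]) (use assms in auto)
qed

text \<open>The first branch omits the value 1. If \<open>T1 x0\<close> exceeded 1, the value 1
  would be attained earlier by continuity; if it were smaller, it would already be a value of the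
  branch, against strict monotonicity.\<close>

lemma T1_x0: "T1 x0 = 1"
proof (rule antisym)
  have T10: "T1 0 = 0" using T1_eq[of 0] T_0 x0 by simp
  show "T1 x0 \<le> 1"
  proof (rule ccontr)
    assume "\<not> T1 x0 \<le> 1"
    then obtain y where "0 \<le> y" "y \<le> x0" "T1 y = 1"
      using IVT'[of T1 0 1 x0] continuous_on_T1 T10 x0 by auto
    then have "y \<in> {0..<x0}" "T y = 1"
      using \<open>\<not> T1 x0 \<le> 1\<close> T1_eq[of y] by (cases "y = x0"; auto)+
    then show False using T1_onto by force
  qed
  show "1 \<le> T1 x0"
  proof (rule ccontr)
    assume "\<not> 1 \<le> T1 x0"
    moreover have "0 < T1 x0" using T1_less[of 0 x0] T10 x0 by simp
    ultimately have "T1 x0 \<in> T ` {0..<x0}" using T1_onto by simp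
    then obtain y where "y \<in> {0..<x0}" "T1 x0 = T y" by auto
    then show False using T1_less[of y x0] T1_eq[of y] by auto
  qed
qed

section \<open>The expansion at the neutral point and the correction term \<delta>0\<close>

lemma T_expansion:
  assumes "x \<in> {0<..<x0}"
  shows "T x = x + x powr (1 + \<alpha>) * (1 + \<delta>0 x)"
  using T1_expansion[of x] T1_eq[of x] assms by (simp add: algebra_simps)

lemma x0_expansion: "1 = x0 + x0 powr (1 + \<alpha>) * (1 + \<delta>0 x0)"
  using T1_expansion[of x0] T1_x0 x0 by (simp add: algebra_simps)

text \<open>Solving the expansion for \<delta>0 lets it inherit the regularity of \<open>T1\<close>,
  so that the sign condition on \<open>deriv \<delta>0\<close> speaks of a genuine
  derivative.\<close>

lemma delta0_eq:
  assumes "x \<in> {0<..x0}"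
  shows "\<delta>0 x = (T1 x - x) * x powr - (1 + \<alpha>) - 1"
proof -
  have "x powr (1 + \<alpha>) * x powr - (1 + \<alpha>) = 1"
    using assms by (simp flip: powr_add)
  moreover have "T1 x - x = x powr (1 + \<alpha>) * (1 + \<delta>0 x)"
    using T1_expansion[OF assms] by (simp add: algebra_simps)
  ultimately have "(T1 x - x) * x powr - (1 + \<alpha>) = 1 + \<delta>0 x"
    by (metis mult.assoc mult.commute mult_1)
  then show ?thesis by simp
qed

lemma delta0_DERIV:
  assumes x: "x \<in> {0<..<x0}"
  shows "(\<delta>0 has_real_derivative
      (deriv T x - 1) * x powr - (1 + \<alpha>) - (1 + \<alpha>) * (T x - x) * x powr (- (1 + \<alpha>) - 1)) (at x)"
proof -
  have "((\<lambda>x. (T x - x) * x powr - (1 + \<alpha>) - 1) has_real_derivative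
      (deriv T x - 1) * x powr - (1 + \<alpha>) - (1 + \<alpha>) * (T x - x) * x powr (- (1 + \<alpha>) - 1)) (at x)"
    using x by (auto intro!: derivative_eq_intros T_DERIV_left simp: algebra_simps)
  then show ?thesis
    by (rule has_field_derivative_transform_within_open[where S="{0<..<x0}"])
       (use x delta0_eq T1_eq in auto)
qed

text \<open>The only use of \<open>\<delta>0' \<ge> 0\<close> besides monotonicity of \<open>\<delta>0\<close>.\<close>

lemma deriv_T_ge:
  assumes x: "x \<in> {0<..<x0}"
  shows "1 + (1 + \<alpha>) * (x powr \<alpha> * (1 + \<delta>0 x)) \<le> deriv T x"
proof -
  let ?p = "x powr (- (1 + \<alpha>) - 1)"
  have p: "x powr - (1 + \<alpha>) = x * ?p" "0 < ?p"
    using x by (simp_all add: powr_mult_base)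
  have "x powr (1 + \<alpha>) = x * x powr \<alpha>"
    using x by (simp add: powr_mult_base)
  then have e: "T x - x = x * (x powr \<alpha> * (1 + \<delta>0 x))"
    using T_expansion[OF x] by simp
  have "0 \<le> (deriv T x - 1) * x powr - (1 + \<alpha>) - (1 + \<alpha>) * (T x - x) * ?p"
    using delta0_deriv[OF x] DERIV_imp_deriv[OF delta0_DERIV[OF x]] by simp
  also have "\<dots> = (x * ?p) * (deriv T x - 1 - (1 + \<alpha>) * (x powr \<alpha> * (1 + \<delta>0 x)))"
    unfolding p(1) e by (simp add: algebra_simps)
  finally have "0 \<le> (x * ?p) * (deriv T x - 1 - (1 + \<alpha>) * (x powr \<alpha> * (1 + \<delta>0 x)))" .
  moreover have "0 < x * ?p"
    using x p(2) by (intro mult_pos_pos) auto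
  ultimately have "0 \<le> deriv T x - 1 - (1 + \<alpha>) * (x powr \<alpha> * (1 + \<delta>0 x))"
    using zero_le_mult_iff not_less by blast
  then show ?thesis by simp
qed

lemma delta0_mono:
  assumes "0 < a" "a \<le> b" "b \<le> x0"
  shows "\<delta>0 a \<le> \<delta>0 b"
proof (rule DERIV_nonneg_imp_increasing_open[OF \<open>a \<le> b\<close>])
  fix x assume "a < x" "x < b"
  then have x: "x \<in> {0<..<x0}" using assms by auto
  show "\<exists>y. (\<delta>0 has_real_derivative y) (at x) \<and> 0 \<le> y"
    using delta0_DERIV[OF x] delta0_deriv[OF x] by (metis DERIV_imp_deriv)
next
  have "continuous_on {a..b} (\<lambda>x. (T1 x - x) * x powr - (1 + \<alpha>) - 1)"
    using assms by (auto intro!: continuous_intros continuous_on_subset[OF continuous_on_T1])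
  then show "continuous_on {a..b} \<delta>0"
    by (rule continuous_on_eq) (use assms delta0_eq in auto)
qed

text \<open>An increasing function with limit 0 at the left end cannot be negative. This is what
  makes the backward orbits satisfy the recursion of \<open>powr_decay\<close>.\<close>

lemma delta0_nonneg:
  assumes "x \<in> {0<..x0}"
  shows "0 \<le> \<delta>0 x"
proof (rule tendsto_upperbound[OF delta0_lim])
  show "\<forall>\<^sub>F y in at_right 0. \<delta>0 y \<le> \<delta>0 x"
    using eventually_at_right_less[of 0] eventually_at_right_real[of 0 x] assms
    by (auto elim!: eventually_mono intro!: delta0_mono)
qed simp

section \<open>Inverse branches, backward orbits and distortion\<close>

abbreviation g :: "real \<Rightarrow> real" where "g \<equiv> inv_branch1 T x0"
abbreviation h :: "real \<Rightarrow> real" where "h \<equiv> inv_branch2 T x0"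

lemma g_props:
  assumes "y \<in> {0<..<1}"
  shows "g y \<in> {0<..<x0}" "T (g y) = y"
proof -
  have y: "y \<in> T ` {0..<x0}" using T1_onto assms by auto
  show Tg: "T (g y) = y"
    unfolding inv_branch1_def by (rule f_inv_into_f[OF y])
  have "g y \<in> {0..<x0}"
    unfolding inv_branch1_def by (rule inv_into_into[OF y])
  moreover have "g y \<noteq> 0" using Tg T_0 assms by auto
  ultimately show "g y \<in> {0<..<x0}" by auto
qed

lemma gpow_in:
  assumes "x \<in> {0<..x0}"
  shows "(g ^^ k) x \<in> {0<..x0}"
proof (induction k)
  case (Suc k)
  then show ?case using g_props(1)[of "(g ^^ k) x"] x0 by auto
qed (use assms in simp)

lemma gpow_Suc:
  assumes "x \<in> {0<..x0}"
  shows "(g ^^ Suc k) x \<in> {0<..<x0}" "T ((g ^^ Suc k) x) = (g ^^ k) x"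
  using g_props[of "(g ^^ k) x"] gpow_in[OF assms, of k] x0 by auto

lemma gpow_decay:
  assumes "x \<in> {0<..x0}"
  shows "(g ^^ Suc k) x \<le> C1 \<alpha> * real (Suc k) powr - (1 / \<alpha>)"
proof (rule powr_decay[OF alpha, where z="\<lambda>k. (g ^^ k) x"])
  show "(g ^^ 0) x \<le> 1" using assms x0 by simp
  fix k
  let ?y = "(g ^^ Suc k) x"
  have y: "?y \<in> {0<..<x0}" by (rule gpow_Suc[OF assms])
  have "?y powr (1 + \<alpha>) * 1 \<le> ?y powr (1 + \<alpha>) * (1 + \<delta>0 ?y)"
    using delta0_nonneg[of ?y] y by (intro mult_left_mono) auto
  then show "?y + ?y powr (1 + \<alpha>) \<le> (g ^^ k) x"
    using T_expansion[OF y] gpow_Suc(2)[OF assms, of k] by simp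
qed

lemma C0_nonneg: "0 \<le> C0 \<alpha> x0 \<delta>0"
  using alpha delta0_nonneg[of x0] x0 by (simp add: C0_def)

text \<open>The Taylor bound applied to \<open>1 + u = T x / x\<close> leaves the quadratic term as
  the only error, and it is at most \<open>?c\<close> once \<open>\<delta>0 x\<close> is replaced by
  its largest value \<open>\<delta>0 x0\<close>.\<close>

lemma distortion:
  assumes x: "x \<in> {0<..<x0}"
  shows "T x powr (1 + \<alpha>) \<le> x powr (1 + \<alpha>) * (deriv T x * exp (C0 \<alpha> x0 \<delta>0 * x powr (2 * \<alpha>)))"
proof -
  define u where "u = x powr \<alpha> * (1 + \<delta>0 x)"
  let ?c = "C0 \<alpha> x0 \<delta>0 * x powr (2 * \<alpha>)"
  have d: "0 \<le> \<delta>0 x" "\<delta>0 x \<le> \<delta>0 x0"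
    using delta0_nonneg[of x] delta0_mono[of x x0] x by auto
  have u: "0 \<le> u" unfolding u_def using d by simp
  have c: "0 \<le> ?c" using C0_nonneg by simp
  have "\<alpha> * (1 + \<alpha>) / 2 * u\<^sup>2 = \<alpha> * (1 + \<alpha>) / 2 * (1 + \<delta>0 x)\<^sup>2 * x powr (2 * \<alpha>)"
    using x by (simp add: u_def power_mult_distrib powr_power mult.commute)
  also have "\<dots> \<le> \<alpha> * (1 + \<alpha>) / 2 * (1 + \<delta>0 x0)\<^sup>2 * x powr (2 * \<alpha>)"
    using d alpha by (intro mult_right_mono mult_left_mono power_mono) auto
  also have "\<dots> = ?c"
    by (simp add: C0_def power2_eq_square algebra_simps)
  finally have quad: "\<alpha> * (1 + \<alpha>) / 2 * u\<^sup>2 \<le> ?c" .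
  have D: "1 + (1 + \<alpha>) * u \<le> deriv T x" "1 < deriv T x"
    using deriv_T_ge[OF x] T_deriv_left[OF x] by (auto simp: u_def)
  have "(1 + u) powr (1 + \<alpha>) \<le> deriv T x + ?c"
    using one_plus_powr_le_quadratic[OF alpha u] quad D by simp
  \<comment> \<open>Since \<open>deriv T x\<close> is at least 1, the additive error can be made a
    factor, as needed for multiplying along an orbit.\<close>
  also have "\<dots> \<le> deriv T x + deriv T x * ?c"
    using mult_right_mono[of 1 "deriv T x" ?c] D c by simp
  also have "\<dots> = deriv T x * (1 + ?c)" by (simp add: algebra_simps)
  also have "\<dots> \<le> deriv T x * exp ?c"
    using D by (intro mult_left_mono exp_ge_add_one_self) auto
  finally have *: "(1 + u) powr (1 + \<alpha>) \<le> deriv T x * exp ?c" .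
  have "T x = x * (1 + u)"
    using T_expansion[OF x] x by (simp add: u_def powr_add algebra_simps)
  then have "T x powr (1 + \<alpha>) = x powr (1 + \<alpha>) * (1 + u) powr (1 + \<alpha>)"
    using x u by (simp add: powr_mult)
  also have "\<dots> \<le> x powr (1 + \<alpha>) * (deriv T x * exp ?c)"
    using * by (intro mult_left_mono) auto
  finally show ?thesis .
qed

text \<open>The product of the one-step distortion bounds: the ratios of consecutive orbit points
  telescope and the exponents add up. Writing the iterate as \<open>T ^^ k\<close> after
  \<open>T\<close> puts the new factor at the deepest point \<open>?z\<close>.\<close>

lemma iterate_DERIV:
  assumes x: "x \<in> {0<..<x0}"
  shows "\<exists>D>0. (T ^^ k has_real_derivative D) (at ((g ^^ k) x)) \<and>
    x powr (1 + \<alpha>) \<le> (g ^^ k) x powr (1 + \<alpha>) *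
      (D * exp (C0 \<alpha> x0 \<delta>0 * (\<Sum>j<k. (g ^^ Suc j) x powr (2 * \<alpha>))))"
proof (induction k)
  case 0
  then show ?case by (auto intro!: exI[of _ 1] simp: id_def)
next
  case (Suc k)
  let ?y = "(g ^^ k) x" and ?z = "(g ^^ Suc k) x"
  let ?E = "\<lambda>k. exp (C0 \<alpha> x0 \<delta>0 * (\<Sum>j<k. (g ^^ Suc j) x powr (2 * \<alpha>)))"
  from Suc obtain D where D: "0 < D" "(T ^^ k has_real_derivative D) (at ?y)"
    "x powr (1 + \<alpha>) \<le> ?y powr (1 + \<alpha>) * (D * ?E k)"
    by blast
  have z: "?z \<in> {0<..<x0}" "T ?z = ?y"
    using gpow_Suc[of x k] x by auto
  have "((T ^^ k) \<circ> T has_real_derivative D * deriv T ?z) (at ?z)"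
    using D(2) T_DERIV_left[OF z(1)] by (intro DERIV_chain) (simp_all only: z)
  then have "(T ^^ Suc k has_real_derivative D * deriv T ?z) (at ?z)"
    by (simp only: funpow_Suc_right)
  moreover have "0 < D * deriv T ?z"
    using D(1) T_deriv_left[OF z(1)] by simp
  moreover have "x powr (1 + \<alpha>) \<le> ?z powr (1 + \<alpha>) * (D * deriv T ?z * ?E (Suc k))"
  proof -
    have "x powr (1 + \<alpha>) \<le> T ?z powr (1 + \<alpha>) * (D * ?E k)"
      using D(3) by (simp only: z)
    also have "\<dots> \<le> ?z powr (1 + \<alpha>) * (deriv T ?z * exp (C0 \<alpha> x0 \<delta>0 * ?z powr (2 * \<alpha>))) * (D * ?E k)"
      using D(1) by (intro mult_right_mono distortion z) auto
    also have "\<dots> = ?z powr (1 + \<alpha>) * (D * deriv T ?z * ?E (Suc k))"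
      by (simp add: exp_add distrib_left mult_ac del: funpow.simps)
    finally show ?thesis .
  qed
  ultimately show ?case by blast
qed

text \<open>By the decay of the orbit, the summand is at most
  \<open>C1 \<alpha> powr (2 * \<alpha>)\<close> over the squared index, and the inverse squares sum
  to at most 2.\<close>

lemma iterate_exp_bound:
  assumes x: "x \<in> {0<..x0}"
  shows "exp (C0 \<alpha> x0 \<delta>0 * (\<Sum>j<k. (g ^^ Suc j) x powr (2 * \<alpha>)))
    \<le> exp (2 * C0 \<alpha> x0 \<delta>0 * C1 \<alpha> powr (2 * \<alpha>))"
proof -
  have "(\<Sum>j<k. (g ^^ Suc j) x powr (2 * \<alpha>)) \<le> (\<Sum>j<k. C1 \<alpha> powr (2 * \<alpha>) * real (Suc j) powr - (1 + 1))"
  proof (rule sum_mono)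
    fix j
    have "(g ^^ Suc j) x powr (2 * \<alpha>) \<le> (C1 \<alpha> * real (Suc j) powr - (1 / \<alpha>)) powr (2 * \<alpha>)"
      using gpow_decay[OF x, of j] gpow_in[OF x, of "Suc j"] alpha by (intro powr_mono2) auto
    also have "\<dots> = C1 \<alpha> powr (2 * \<alpha>) * real (Suc j) powr - (1 + 1)"
      using C1_ge_1[OF alpha] alpha by (subst powr_mult) (auto simp: powr_powr)
    finally show "(g ^^ Suc j) x powr (2 * \<alpha>) \<le> C1 \<alpha> powr (2 * \<alpha>) * real (Suc j) powr - (1 + 1)" .
  qed
  also have "\<dots> \<le> C1 \<alpha> powr (2 * \<alpha>) * (1 + 1 / 1)"
    unfolding sum_distrib_left[symmetric] by (intro mult_left_mono sum_powr_Suc_le) auto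
  finally have "C0 \<alpha> x0 \<delta>0 * (\<Sum>j<k. (g ^^ Suc j) x powr (2 * \<alpha>)) \<le> C0 \<alpha> x0 \<delta>0 * (C1 \<alpha> powr (2 * \<alpha>) * 2)"
    using C0_nonneg by (intro mult_left_mono) auto
  then show ?thesis by (simp add: mult_ac)
qed

section \<open>The expanding branch and the weights\<close>

text \<open>The absolute values treat an increasing and a decreasing second branch alike. Both
  injectivity and the contraction of preimages come from here.\<close>

lemma T2_expanding:
  assumes "a \<in> {x0..1}" "b \<in> {x0..1}"
  shows "\<beta> * \<bar>a - b\<bar> \<le> \<bar>T a - T b\<bar>"
proof -
  have *: "\<beta> * \<bar>a - b\<bar> \<le> \<bar>T a - T b\<bar>" if ab: "a < b" "a \<in> {x0..1}" "b \<in> {x0..1}" for a b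
  proof -
    have "continuous_on {a..b} T"
      by (rule continuous_on_subset[OF continuous_on_T2]) (use ab in auto)
    moreover have "T differentiable at x" if "a < x" "x < b" for x
      using T_DERIV_right[of x] that ab by (auto simp: real_differentiable_def)
    ultimately obtain l z where z: "a < z" "z < b" "DERIV T z :> l" "T b - T a = (b - a) * l"
      using MVT[OF ab(1), of T] by blast
    have "\<beta> \<le> \<bar>l\<bar>"
      using T_deriv_right[of z] z ab DERIV_imp_deriv[OF z(3)] by auto
    then have "\<beta> * (b - a) \<le> \<bar>l\<bar> * (b - a)"
      using ab by (intro mult_right_mono) auto
    also have "\<dots> = \<bar>T b - T a\<bar>"
      using ab by (simp add: z(4) abs_mult)
    finally show ?thesis using ab by (simp add: abs_minus_commute)
  qed
  consider "a < b" | "a = b" | "b < a" by linarith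
  then show ?thesis
    using *[of a b] *[of b a] assms by cases (auto simp: abs_minus_commute)
qed

lemma inj_on_T2: "inj_on T {x0..1}"
proof (rule inj_onI)
  fix a b assume "a \<in> {x0..1}" "b \<in> {x0..1}" "T a = T b"
  with T2_expanding[of a b] beta show "a = b" by (simp add: mult_le_0_iff)
qed

text \<open>A continuous injection of an interval is monotone, so its extreme values sit at the
  endpoints. It follows that preimages of (0,1) avoid \<open>x0\<close> and 1, where the derivative
  bound is not assumed.\<close>

lemma T2_endpoints: "T x0 \<in> {0, 1}" "T 1 \<in> {0, 1}"
proof -
  have range: "T x0 \<in> {0..1}" "T 1 \<in> {0..1}"
    using T2_onto x0 by auto
  have "0 \<in> T ` {x0..1}" "1 \<in> T ` {x0..1}" using T2_onto by auto
  then obtain u v where uv: "u \<in> {x0..1}" "T u = 0" "v \<in> {x0..1}" "T v = 1" by force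
  have "strict_mono_on {x0..1} T \<or> strict_antimono_on {x0..1} T"
    using injective_eq_monotone_map[of "{x0..1}" T] continuous_on_T2 inj_on_T2
    by (simp add: is_interval_cc)
  then have "mono_on {x0..1} T \<or> antimono_on {x0..1} T"
    by (auto simp: monotone_on_def le_less)
  then have "T x0 \<in> {0, 1} \<and> T 1 \<in> {0, 1}"
  proof
    assume "mono_on {x0..1} T"
    from mono_onD[OF this, of x0 u] mono_onD[OF this, of v 1]
    show ?thesis using uv range by auto
  next
    assume "antimono_on {x0..1} T"
    from monotone_onD[OF this, of u 1] monotone_onD[OF this, of x0 v]
    show ?thesis using uv range by auto
  qed
  then show "T x0 \<in> {0, 1}" "T 1 \<in> {0, 1}" by auto
qed

lemma T2_interior:
  assumes "y \<in> {x0..1}" "T y \<in> {0<..<1}"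
  shows "y \<in> {x0<..<1}"
  using assms T2_endpoints by (cases "y = x0"; cases "y = 1") auto

lemma h_props:
  assumes "z \<in> {0<..<1}"
  shows "h z \<in> {x0<..<1}" "T (h z) = z"
proof -
  have z: "z \<in> T ` {x0..1}" using T2_onto assms by auto
  show Th: "T (h z) = z"
    unfolding inv_branch2_def by (rule f_inv_into_f[OF z])
  show "h z \<in> {x0<..<1}"
  proof (rule T2_interior)
    show "h z \<in> {x0..1}"
      unfolding inv_branch2_def by (rule inv_into_into[OF z])
  qed (use Th assms in simp)
qed

text \<open>The factor of the density in the series off \<open>{x0..1}\<close>. Index
  \<open>n\<close> stands for \<open>n + 1\<close> iterates: one step by the second branch, then
  \<open>n\<close> steps by the first.\<close>

definition weight :: "real \<Rightarrow> nat \<Rightarrow> real" where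
  "weight x n = 1 / \<bar>deriv (T ^^ Suc n) (h ((g ^^ n) x))\<bar>"

lemma weight_nonneg: "0 \<le> weight x n"
  by (simp add: weight_def)

text \<open>The chain rule splits off the step by the second branch, which contributes at most
  \<open>1 / \<beta>\<close>; the remaining iterate starts at \<open>(g ^^ n) x\<close> and is
  covered by \<open>iterate_DERIV\<close>.\<close>

lemma weight_le:
  assumes x: "x \<in> {0<..<x0}"
  shows "weight x n \<le> (g ^^ n) x powr (1 + \<alpha>) *
    exp (C0 \<alpha> x0 \<delta>0 * (\<Sum>j<n. (g ^^ Suc j) x powr (2 * \<alpha>))) / (\<beta> * x powr (1 + \<alpha>))"
proof -
  let ?z = "(g ^^ n) x"
  let ?y = "h ?z"
  let ?E = "exp (C0 \<alpha> x0 \<delta>0 * (\<Sum>j<n. (g ^^ Suc j) x powr (2 * \<alpha>)))"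
  have z: "?z \<in> {0<..<1}" using gpow_in[of x n] x x0 by auto
  obtain D where D: "0 < D" "(T ^^ n has_real_derivative D) (at ?z)"
    "x powr (1 + \<alpha>) \<le> ?z powr (1 + \<alpha>) * (D * ?E)"
    using iterate_DERIV[OF x, of n] by blast
  have y: "?y \<in> {x0<..<1}" "T ?y = ?z" using h_props[OF z] by auto
  have "((T ^^ n) \<circ> T has_real_derivative D * deriv T ?y) (at ?y)"
    using D(2) T_DERIV_right[OF y(1)] by (intro DERIV_chain) (simp_all only: y)
  then have "deriv (T ^^ Suc n) ?y = D * deriv T ?y"
    by (metis funpow_Suc_right DERIV_imp_deriv)
  then have w: "weight x n = 1 / (D * \<bar>deriv T ?y\<bar>)"
    using D(1) by (simp add: weight_def abs_mult)
  have "D * \<beta> \<le> D * \<bar>deriv T ?y\<bar>"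
    using T_deriv_right[OF y(1)] D(1) by simp
  then have "weight x n \<le> 1 / (D * \<beta>)"
    unfolding w using D(1) beta by (intro divide_left_mono) auto
  also have "\<dots> \<le> ?z powr (1 + \<alpha>) * ?E / (\<beta> * x powr (1 + \<alpha>))"
    using D x beta by (simp add: field_simps)
  finally show ?thesis .
qed

text \<open>The orbit decay says nothing at index 0, so only \<open>x < x0\<close> is used. This is
  the origin of the summand \<open>x0 powr (1 + \<alpha>) / \<beta>\<close> of
  \<open>C_star\<close>.\<close>

lemma weight_0_le:
  assumes x: "x \<in> {0<..<x0}"
  shows "weight x 0 \<le> x0 powr (1 + \<alpha>) / \<beta> / x powr (1 + \<alpha>)"
proof -
  have "weight x 0 \<le> x powr (1 + \<alpha>) / (\<beta> * x powr (1 + \<alpha>))"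
    using weight_le[OF x, of 0] by simp
  also have "\<dots> \<le> x0 powr (1 + \<alpha>) / (\<beta> * x powr (1 + \<alpha>))"
    using x alpha beta by (intro divide_right_mono powr_mono2) auto
  finally show ?thesis by simp
qed

lemma weight_Suc_le:
  assumes x: "x \<in> {0<..<x0}"
  shows "weight x (Suc n) \<le> M_const \<alpha> x0 \<beta> \<delta>0 / x powr (1 + \<alpha>) * real (Suc n) powr - (1 + 1 / \<alpha>)"
proof -
  let ?e = "exp (2 * C0 \<alpha> x0 \<delta>0 * C1 \<alpha> powr (2 * \<alpha>))"
  have x': "x \<in> {0<..x0}" using x by auto
  have "(g ^^ Suc n) x powr (1 + \<alpha>) \<le> (C1 \<alpha> * real (Suc n) powr - (1 / \<alpha>)) powr (1 + \<alpha>)"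
    using gpow_decay[OF x', of n] gpow_in[OF x', of "Suc n"] alpha by (intro powr_mono2) auto
  also have "\<dots> = C1 \<alpha> powr (1 + \<alpha>) * real (Suc n) powr (- (1 / \<alpha>) * (1 + \<alpha>))"
    using C1_ge_1[OF alpha] by (subst powr_mult) (auto simp: powr_powr)
  also have "- (1 / \<alpha>) * (1 + \<alpha>) = - (1 + 1 / \<alpha>)"
    using alpha by (simp add: field_simps)
  finally have *: "(g ^^ Suc n) x powr (1 + \<alpha>) \<le> C1 \<alpha> powr (1 + \<alpha>) * real (Suc n) powr - (1 + 1 / \<alpha>)" .
  have "weight x (Suc n) \<le> (C1 \<alpha> powr (1 + \<alpha>) * real (Suc n) powr - (1 + 1 / \<alpha>)) * ?e / (\<beta> * x powr (1 + \<alpha>))"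
    by (rule order_trans[OF weight_le[OF x]], intro divide_right_mono mult_mono * iterate_exp_bound x')
       (use beta in auto)
  also have "\<dots> = M_const \<alpha> x0 \<beta> \<delta>0 / x powr (1 + \<alpha>) * real (Suc n) powr - (1 + 1 / \<alpha>)"
    by (simp add: M_const_def)
  finally show ?thesis .
qed

lemma
  assumes x: "x \<in> {0<..<x0}"
  shows summable_weight: "summable (weight x)"
    and suminf_weight_le:
      "(\<Sum>n. weight x n) \<le> (x0 powr (1 + \<alpha>) / \<beta> + M_const \<alpha> x0 \<beta> \<delta>0 * (1 + \<alpha>)) / x powr (1 + \<alpha>)"
proof -
  let ?K = "M_const \<alpha> x0 \<beta> \<delta>0 / x powr (1 + \<alpha>)"
  have s: "0 < 1 / \<alpha>" using alpha by simp
  have K: "0 \<le> ?K" using beta by (simp add: M_const_def)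
  have sm: "summable (\<lambda>n. ?K * real (Suc n) powr - (1 + 1 / \<alpha>))"
    by (intro summable_mult summable_powr_Suc s)
  have sw: "summable (\<lambda>n. weight x (Suc n))"
    by (rule summable_comparison_test_ev[OF _ sm])
       (use weight_Suc_le[OF x] weight_nonneg in auto)
  then show w: "summable (weight x)" by (simp add: summable_Suc_iff)
  have "(\<Sum>n. weight x (Suc n)) \<le> (\<Sum>n. ?K * real (Suc n) powr - (1 + 1 / \<alpha>))"
    by (intro suminf_le sw sm weight_Suc_le x)
  also have "\<dots> = ?K * (\<Sum>n. real (Suc n) powr - (1 + 1 / \<alpha>))"
    by (intro suminf_mult summable_powr_Suc s)
  \<comment> \<open>The power sum with \<open>s = 1 / \<alpha>\<close> is at most
    \<open>1 + \<alpha>\<close>, the factor beside \<open>M_const\<close> in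
    \<open>C_star\<close>.\<close>
  also have "\<dots> \<le> ?K * (1 + 1 / (1 / \<alpha>))"
    by (intro mult_left_mono suminf_powr_Suc_le s K)
  finally have "(\<Sum>n. weight x (Suc n)) \<le> ?K * (1 + \<alpha>)" by simp
  then have "(\<Sum>n. weight x n) \<le> x0 powr (1 + \<alpha>) / \<beta> / x powr (1 + \<alpha>) + ?K * (1 + \<alpha>)"
    using suminf_split_head[OF w] weight_0_le[OF x] by simp
  then show "(\<Sum>n. weight x n) \<le> (x0 powr (1 + \<alpha>) / \<beta> + M_const \<alpha> x0 \<beta> \<delta>0 * (1 + \<alpha>)) / x powr (1 + \<alpha>)"
    by (simp add: add_divide_distrib)
qed


section \<open>Normalized Lebesgue measure and return times\<close>

lemma lambda_hat_eq_density:
  "lambda_hat x0 = density lebesgue (\<lambda>x. ennreal (indicator {x0..1} x / (1 - x0)))"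
proof -
  have "indicator {x0..1} x / emeasure lebesgue {x0..1} = ennreal (indicator {x0..1} x / (1 - x0))" for x
    using x0 by (auto simp: indicator_def divide_ennreal[symmetric])
  then show ?thesis
    by (simp add: lambda_hat_def uniform_measure_def)
qed

lemma sets_lambda_hat [simp, measurable_cong]: "sets (lambda_hat x0) = sets lebesgue"
  by (simp add: lambda_hat_def)

lemma space_lambda_hat [simp]: "space (lambda_hat x0) = UNIV"
  by (simp add: lambda_hat_def)

lemma measure_lambda_hat:
  assumes "A \<in> sets lebesgue" "A \<subseteq> {x0..1}"
  shows "measure (lambda_hat x0) A = measure lebesgue A / (1 - x0)"
proof -
  have "{x0..1} \<inter> A = A" using assms by auto
  then show ?thesis
    using x0 assms unfolding lambda_hat_def by (subst measure_uniform_measure) auto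
qed

lemma finite_measure_lambda_hat: "finite_measure (lambda_hat x0)"
proof
  show "emeasure (lambda_hat x0) (space (lambda_hat x0)) \<noteq> \<infinity>"
    unfolding lambda_hat_def using x0 by (simp add: ennreal_divide_eq_top_iff)
qed

lemma AE_lambda_hat_iff:
  "(AE x in lambda_hat x0. P x) \<longleftrightarrow> (AE x in lebesgue. x \<in> {x0..1} \<longrightarrow> P x)"
  unfolding lambda_hat_def using x0 by (intro AE_uniform_measure) auto

lemma continuous_on_Icc_bounded:
  assumes "continuous_on {x0..1} f"
  obtains B :: real where "\<And>x. x \<in> {x0..1} \<Longrightarrow> \<bar>f x :: real\<bar> \<le> B"
proof -
  have "bounded (f ` {x0..1})"
    by (intro compact_imp_bounded compact_continuous_image assms) simp
  then obtain B where "\<forall>y\<in>f ` {x0..1}. norm y \<le> B"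
    unfolding bounded_iff by blast
  then show ?thesis by (intro that[of B]) auto
qed

lemma set_integrable_lambda_hat:
  assumes f: "continuous_on {x0..1} f" and A: "A \<in> sets lebesgue" "A \<subseteq> {x0..1}"
  shows "set_integrable (lambda_hat x0) A (f :: real \<Rightarrow> real)"
proof (rule set_integrable_subset[OF _ _ A(2)])
  obtain B where B: "\<And>x. x \<in> {x0..1} \<Longrightarrow> \<bar>f x\<bar> \<le> B"
    using continuous_on_Icc_bounded[OF f] by blast
  have "0 \<le> B" using order_trans[OF abs_ge_zero B[of x0]] x0 by simp
  have "(\<lambda>x. indicator {x0..1} x *\<^sub>R f x) \<in> borel_measurable borel"
    by (rule borel_measurable_continuous_on_indicator) (use f in auto)
  then have "(\<lambda>x. indicator {x0..1} x *\<^sub>R f x) \<in> borel_measurable (lambda_hat x0)"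
    by (subst measurable_cong_sets[OF sets_lambda_hat refl], intro measurable_completion) simp
  then show "set_integrable (lambda_hat x0) {x0..1} f"
    unfolding set_integrable_def
    by (intro finite_measure.integrable_const_bound[OF finite_measure_lambda_hat, where B=B])
       (use B \<open>0 \<le> B\<close> in \<open>auto simp: indicator_def\<close>)
qed (use A in simp)

lemma density_mass_le:
  assumes f: "continuous_on {x0..1} f" and A: "A \<in> sets lebesgue" "A \<subseteq> {x0..1}"
    and B: "\<And>x. x \<in> A \<Longrightarrow> \<bar>f x\<bar> \<le> B"
  shows "\<bar>density_mass x0 f A\<bar> \<le> B * measure (lambda_hat x0) A"
proof -
  interpret finite_measure "lambda_hat x0" by (rule finite_measure_lambda_hat)
  have c: "(LINT x:A|lambda_hat x0. c) = c * measure (lambda_hat x0) A" for c :: real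
    using A by (simp add: set_lebesgue_integral_def)
  note i = set_integrable_lambda_hat[OF _ A]
  have "density_mass x0 f A \<le> (LINT x:A|lambda_hat x0. B)"
    unfolding density_mass_def using B by (intro set_integral_mono i f continuous_on_const) (auto simp: abs_le_iff)
  moreover have "(LINT x:A|lambda_hat x0. - B) \<le> density_mass x0 f A"
    unfolding density_mass_def using B by (intro set_integral_mono i f continuous_on_const) (auto simp: abs_le_iff minus_le_iff)
  ultimately show ?thesis
    unfolding c by auto
qed

lemma density_mass_diff:
  assumes "continuous_on {x0..1} f" "continuous_on {x0..1} f'" "A \<in> sets lebesgue" "A \<subseteq> {x0..1}"
  shows "density_mass x0 f A - density_mass x0 f' A = density_mass x0 (\<lambda>x. f x - f' x) A"
  unfolding density_mass_def using assms
  by (simp add: set_integrable_lambda_hat)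

lemma density_mass_nonneg:
  assumes "is_density x0 f" "A \<subseteq> {x0..1}"
  shows "0 \<le> density_mass x0 f A"
  unfolding density_mass_def set_lebesgue_integral_def
  using assms by (intro Bochner_Integration.integral_nonneg) (auto simp: is_density_def indicator_def)

section \<open>Cut points and the measure of the return cells\<close>

lemma cut_in: "cut T x0 n \<in> {0<..x0}"
  unfolding cut_def using gpow_in[of x0 n] x0 by simp

lemma cut_diff:
  "cut T x0 n - cut T x0 (Suc n) = cut T x0 (Suc n) powr (1 + \<alpha>) * (1 + \<delta>0 (cut T x0 (Suc n)))"
  using gpow_Suc[of x0 n] x0 T_expansion[of "cut T x0 (Suc n)"] unfolding cut_def by simp

lemma cut_Suc_less: "cut T x0 (Suc n) < cut T x0 n"
proof -
  have "0 < cut T x0 (Suc n) powr (1 + \<alpha>) * (1 + \<delta>0 (cut T x0 (Suc n)))"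
    using cut_in[of "Suc n"] delta0_nonneg[OF cut_in, of "Suc n"] by auto
  then show ?thesis using cut_diff[of n] by linarith
qed

lemma decseq_cut: "decseq (cut T x0)"
  by (rule decseq_SucI) (rule less_imp_le[OF cut_Suc_less])

lemma cut_Suc_le: "cut T x0 (Suc n) \<le> C1 \<alpha> * real (Suc n) powr - (1 / \<alpha>)"
  unfolding cut_def by (rule gpow_decay) (use x0 in simp)

lemma ex_cut_less:
  assumes "0 < t"
  shows "\<exists>n. cut T x0 n < t"
proof -
  have "filterlim (\<lambda>n. real (Suc n)) at_top sequentially"
    by (rule filterlim_compose[OF filterlim_real_sequentially filterlim_Suc])
  then have "(\<lambda>n. real (Suc n) powr - (1 / \<alpha>)) \<longlonglongrightarrow> 0"
    by (intro tendsto_neg_powr) (use alpha in auto)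
  then have "(\<lambda>n. C1 \<alpha> * real (Suc n) powr - (1 / \<alpha>)) \<longlonglongrightarrow> C1 \<alpha> * 0"
    by (intro tendsto_intros)
  then have "\<forall>\<^sub>F n in sequentially. C1 \<alpha> * real (Suc n) powr - (1 / \<alpha>) < t"
    using assms by (auto dest!: order_tendstoD(2))
  then obtain n where "C1 \<alpha> * real (Suc n) powr - (1 / \<alpha>) < t"
    using eventually_happens by fastforce
  then show ?thesis using cut_Suc_le[of n] by (intro exI[of _ "Suc n"]) simp
qed

text \<open>Shows \<open>C2\<close> to be the constant in the gap of two cut points,
  \<open>cut_diff\<close>: the orbit decay contributes the power of \<open>C1\<close>, and
  evaluating the expansion at \<open>x0\<close> identifies \<open>1 + \<delta>0 x0\<close> with
  \<open>(1 - x0) / x0 powr (1 + \<alpha>)\<close>.\<close>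

lemma C2_eq: "C2 \<alpha> x0 = (1 + \<delta>0 x0) * C1 \<alpha> powr (1 + \<alpha>)"
proof -
  have "(2 * ((2::real) powr (1 / \<alpha>) - 1)) powr (1 + 1 / \<alpha>)
      = 2 powr (1 + 1 / \<alpha>) * (2 powr (1 / \<alpha>) - 1) powr (1 + 1 / \<alpha>)"
    by (rule powr_mult)
  moreover have "1 / \<alpha> * (1 + \<alpha>) = 1 + 1 / \<alpha>"
    using alpha by (simp add: field_simps)
  ultimately have "C1 \<alpha> powr (1 + \<alpha>) = 2 powr (1 + 1 / \<alpha>) * (2 powr (1 / \<alpha>) - 1) powr (1 + 1 / \<alpha>)"
    unfolding C1_def powr_powr by metis
  moreover have "1 + \<delta>0 x0 = (1 - x0) / x0 powr (1 + \<alpha>)"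
    using x0_expansion x0 by (simp add: field_simps)
  ultimately show ?thesis by (simp add: C2_def)
qed

lemma C2_nonneg: "0 \<le> C2 \<alpha> x0"
  using delta0_nonneg[of x0] x0 by (simp add: C2_eq)

lemma cut_diff_le: "cut T x0 n - cut T x0 (Suc n) \<le> C2 \<alpha> x0 * real (Suc n) powr - (1 + 1 / \<alpha>)"
proof -
  let ?c = "cut T x0 (Suc n)"
  have c: "?c \<in> {0<..x0}" by (rule cut_in)
  have "?c powr (1 + \<alpha>) \<le> (C1 \<alpha> * real (Suc n) powr - (1 / \<alpha>)) powr (1 + \<alpha>)"
    using cut_Suc_le c alpha by (intro powr_mono2) auto
  also have "\<dots> = C1 \<alpha> powr (1 + \<alpha>) * real (Suc n) powr (- (1 / \<alpha>) * (1 + \<alpha>))"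
    using C1_ge_1[OF alpha] by (subst powr_mult) (auto simp: powr_powr)
  also have "- (1 / \<alpha>) * (1 + \<alpha>) = - (1 + 1 / \<alpha>)"
    using alpha by (simp add: field_simps)
  finally have *: "?c powr (1 + \<alpha>) \<le> C1 \<alpha> powr (1 + \<alpha>) * real (Suc n) powr - (1 + 1 / \<alpha>)" .
  have "?c powr (1 + \<alpha>) * (1 + \<delta>0 ?c) \<le> (C1 \<alpha> powr (1 + \<alpha>) * real (Suc n) powr - (1 + 1 / \<alpha>)) * (1 + \<delta>0 x0)"
    using * delta0_nonneg[OF c] delta0_mono[of ?c x0] c by (intro mult_mono) auto
  then show ?thesis
    unfolding cut_diff C2_eq by (simp only: mult_ac)
qed

lemma Z_subset: "Z T x0 n \<subseteq> {x0..1}"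
  by (auto simp: Z_def)

lemma Z_sets: "Z T x0 n \<in> sets lebesgue"
proof -
  have "open (W T x0 (n - 1))" by (simp add: W_def)
  then obtain U where "open U" "{x0..1} \<inter> T -` W T x0 (n - 1) = {x0..1} \<inter> U"
    using continuous_openin_preimage_gen[OF continuous_on_T2] unfolding openin_open by metis
  moreover have "Z T x0 n = {x0..1} \<inter> T -` W T x0 (n - 1)" by (auto simp: Z_def)
  ultimately show ?thesis by (auto simp: borel_open)
qed

text \<open>Expansion bounds the diameter of \<open>S\<close> by \<open>(b - a) / \<beta>\<close>,
  and the interval from \<open>Inf S\<close> to \<open>Sup S\<close> bounds its measure by its
  diameter.\<close>

lemma measure_T2_preimage_le:
  assumes S: "S \<in> sets lebesgue" "S \<subseteq> {x0..1}" and T: "T ` S \<subseteq> {a<..<b}" and "a \<le> b"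
  shows "measure lebesgue S \<le> (b - a) / \<beta>"
proof (cases "S = {}")
  case True
  then show ?thesis using \<open>a \<le> b\<close> beta by simp
next
  case False
  have bdd: "bdd_below S" "bdd_above S"
    using S(2) by (auto intro: bdd_below_mono bdd_above_mono)
  have "u - v \<le> (b - a) / \<beta>" if "u \<in> S" "v \<in> S" for u v
  proof -
    have "\<beta> * \<bar>u - v\<bar> \<le> \<bar>T u - T v\<bar>" using that S(2) by (intro T2_expanding) auto
    also have "\<dots> \<le> b - a" using that T by (auto simp: abs_le_iff image_subset_iff intro!: diff_mono)
    finally have "\<bar>u - v\<bar> \<le> (b - a) / \<beta>" using beta by (simp add: field_simps)
    then show ?thesis by simp
  qed
  then have "u - (b - a) / \<beta> \<le> Inf S" if "u \<in> S" for u
    using that False by (intro cInf_greatest) (auto simp: algebra_simps)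
  then have "Sup S \<le> Inf S + (b - a) / \<beta>"
    using False by (intro cSup_least) (auto simp: algebra_simps)
  moreover have "S \<subseteq> {Inf S..Sup S}"
    using bdd by (auto intro: cInf_lower cSup_upper)
  then have "measure lebesgue S \<le> measure lebesgue {Inf S..Sup S}"
    using S(1) by (intro measure_mono_fmeasurable) auto
  moreover have "Inf S \<le> Sup S"
    using False bdd by (auto intro: cInf_le_cSup)
  ultimately show ?thesis by simp
qed

lemma measure_Z_1_le: "measure (lambda_hat x0) (Z T x0 (Suc 0)) \<le> 1 / \<beta>"
proof -
  have "measure lebesgue (Z T x0 (Suc 0)) \<le> (1 - x0) / \<beta>"
    by (rule measure_T2_preimage_le[OF Z_sets Z_subset]) (use x0 in \<open>auto simp: Z_def W_def\<close>)
  then show ?thesis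
    using x0 by (simp add: measure_lambda_hat[OF Z_sets Z_subset] divide_le_eq)
qed

text \<open>The cell with index \<open>n + 2\<close> is the preimage of \<open>W\<close> at
  \<open>n + 1\<close>, the gap between the cuts \<open>n + 1\<close> and \<open>n\<close>; hence
  the shift by two.\<close>

lemma measure_Z_Suc_le:
  "measure (lambda_hat x0) (Z T x0 (Suc (Suc n)))
    \<le> C2 \<alpha> x0 / (\<beta> * (1 - x0)) * real (Suc n) powr - (1 + 1 / \<alpha>)"
proof -
  have "measure lebesgue (Z T x0 (Suc (Suc n))) \<le> (cut T x0 n - cut T x0 (Suc n)) / \<beta>"
    by (rule measure_T2_preimage_le[OF Z_sets Z_subset])
       (use cut_Suc_less[of n] in \<open>auto simp: Z_def W_def\<close>)
  also have "\<dots> \<le> C2 \<alpha> x0 * real (Suc n) powr - (1 + 1 / \<alpha>) / \<beta>"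
    using cut_diff_le[of n] beta by (intro divide_right_mono) auto
  finally have "measure lebesgue (Z T x0 (Suc (Suc n))) / (1 - x0)
      \<le> C2 \<alpha> x0 * real (Suc n) powr - (1 + 1 / \<alpha>) / \<beta> / (1 - x0)"
    using x0 by (intro divide_right_mono) auto
  then show ?thesis
    by (simp add: measure_lambda_hat[OF Z_sets Z_subset])
qed

abbreviation weighted_return :: "nat \<Rightarrow> real" where
  "weighted_return k \<equiv> real (Suc k) * measure (lambda_hat x0) (Z T x0 (Suc k))"

lemma
  shows summable_weighted_return: "summable weighted_return"
    and suminf_weighted_return_le: "(\<Sum>k. weighted_return k) \<le> C3 \<alpha> x0 \<beta>"
proof -
  define K where "K = C2 \<alpha> x0 / (\<beta> * (1 - x0))"
  have K: "0 \<le> K" using C2_nonneg beta x0 by (simp add: K_def)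
  let ?a = "\<lambda>s n. real (Suc n) powr - (1 + s)"
  have s: "0 < 1 / \<alpha>" "0 < 1 / \<alpha> - 1" using alpha by auto
  have le: "weighted_return (Suc n) \<le> K * (?a (1 / \<alpha> - 1) n + ?a (1 / \<alpha>) n)" for n
  proof -
    have "weighted_return (Suc n) \<le> real (Suc (Suc n)) * (K * ?a (1 / \<alpha>) n)"
      unfolding K_def by (intro mult_left_mono measure_Z_Suc_le) simp
    \<comment> \<open>The return time \<open>n + 2\<close> is split as \<open>(n + 1) + 1\<close>.
      This gives power sums with exponents \<open>1 / \<alpha>\<close> and
      \<open>1 + 1 / \<alpha>\<close>; the first converges because \<open>\<alpha> < 1\<close>, and
      their bounds \<open>1 / (1 - \<alpha>)\<close> and \<open>1 + \<alpha>\<close> add up to the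
      bracket in \<open>C3\<close>.\<close>
    also have "\<dots> = K * (real (Suc n) * ?a (1 / \<alpha>) n + ?a (1 / \<alpha>) n)"
      by (simp add: algebra_simps)
    also have "real (Suc n) * ?a (1 / \<alpha>) n = ?a (1 / \<alpha> - 1) n"
      by (simp add: powr_mult_base)
    finally show ?thesis .
  qed
  have sm: "summable (\<lambda>n. K * (?a (1 / \<alpha> - 1) n + ?a (1 / \<alpha>) n))"
    by (intro summable_mult summable_add summable_powr_Suc s)
  have sr: "summable (\<lambda>n. weighted_return (Suc n))"
    by (rule summable_comparison_test_ev[OF _ sm]) (use le in auto)
  then show r: "summable weighted_return" by (rule summable_Suc_iff[THEN iffD1])
  have "(\<Sum>n. weighted_return (Suc n)) \<le> (\<Sum>n. K * (?a (1 / \<alpha> - 1) n + ?a (1 / \<alpha>) n))"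
    by (intro suminf_le sr sm le)
  also have "\<dots> = K * ((\<Sum>n. ?a (1 / \<alpha> - 1) n) + (\<Sum>n. ?a (1 / \<alpha>) n))"
    by (subst suminf_mult, intro summable_add summable_powr_Suc s)
       (subst suminf_add, (intro summable_powr_Suc s)+, rule refl)
  also have "\<dots> \<le> K * ((1 + 1 / (1 / \<alpha> - 1)) + (1 + 1 / (1 / \<alpha>)))"
    by (intro mult_left_mono add_mono suminf_powr_Suc_le s K)
  also have "(1 + 1 / (1 / \<alpha> - 1)) + (1 + 1 / (1 / \<alpha>)) = \<alpha> + (2 - \<alpha>) / (1 - \<alpha>)"
    using alpha by (simp add: divide_simps) (simp add: algebra_simps)
  finally show "(\<Sum>k. weighted_return k) \<le> C3 \<alpha> x0 \<beta>"
    using suminf_split_head[OF r] measure_Z_1_le by (simp add: C3_def K_def)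
qed

lemma C3_nonneg: "0 \<le> C3 \<alpha> x0 \<beta>"
  using suminf_weighted_return_le suminf_nonneg[OF summable_weighted_return] by simp

lemma disjoint_Z:
  assumes "i \<noteq> j"
  shows "Z T x0 (Suc i) \<inter> Z T x0 (Suc j) = {}"
proof -
  have "W T x0 i \<inter> W T x0 j = {}" if "i < j" for i j
  proof -
    have "cut T x0 i < t" if "t \<in> W T x0 i" for t
      using that by (cases "i = 0") (auto simp: W_def cut_def)
    moreover have "t < cut T x0 i" if "t \<in> W T x0 j" for t
    proof -
      have "cut T x0 (j - 1) \<le> cut T x0 i"
        using \<open>i < j\<close> by (intro decseqD[OF decseq_cut]) simp
      then show ?thesis using that \<open>i < j\<close> by (auto simp: W_def)
    qed
    ultimately show ?thesis by fastforce
  qed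
  from this[of i j] this[of j i] assms show ?thesis
    by (cases "i < j") (auto simp: Z_def)
qed

text \<open>Cuts decrease to 0, so a value in (0,1) that is no cut lies in \<open>W\<close> at the
  least index whose cut is below it. The missed points therefore map injectively into 0, 1 and the
  cuts.\<close>

lemma countable_diff_Z: "countable ({x0..1} - (\<Union>k. Z T x0 (Suc k)))" (is "countable ?S")
proof -
  have "T ` ?S \<subseteq> {0, 1} \<union> range (cut T x0)"
  proof
    fix t assume "t \<in> T ` ?S"
    then obtain y where y: "t = T y" "y \<in> {x0..1}" "\<And>k. t \<notin> W T x0 k"
      by (fastforce simp: Z_def)
    show "t \<in> {0, 1} \<union> range (cut T x0)"
    proof (rule ccontr)
      assume t: "t \<notin> {0, 1} \<union> range (cut T x0)"
      have "T y \<in> {0..1}" using y(2) T2_onto by blast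
      then have t01: "0 < t" "t < 1" using t y(1) by auto
      define n where "n = (LEAST n. cut T x0 n < t)"
      have n: "cut T x0 n < t"
        unfolding n_def using ex_cut_less[OF t01(1)] by (rule LeastI_ex)
      show False
      proof (cases n)
        case 0
        then show False using n t01 y(3)[of 0] by (simp add: W_def cut_def)
      next
        case (Suc k)
        then have "\<not> cut T x0 k < t"
          unfolding n_def using not_less_Least[of k "\<lambda>n. cut T x0 n < t"] by simp
        moreover have "t \<noteq> cut T x0 k" using t by auto
        ultimately show False using n Suc y(3)[of n] by (simp add: W_def)
      qed
    qed
  qed
  then have "countable (T ` ?S)"
    by (rule countable_subset) auto
  moreover have "inj_on T ?S"
    by (rule inj_on_subset[OF inj_on_T2]) auto
  ultimately show ?thesis by (rule countable_image_inj_on)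
qed

lemma suminf_density_mass:
  assumes f: "continuous_on {x0..1} f" "is_density x0 f"
  shows "(\<Sum>k. density_mass x0 f (Z T x0 (Suc k))) = 1"
proof -
  let ?U = "\<Union>k. Z T x0 (Suc k)"
  have U: "?U \<in> sets lebesgue" "?U \<subseteq> {x0..1}"
    using Z_sets Z_subset by blast+
  have "(\<Sum>k. density_mass x0 f (Z T x0 (Suc k))) = (LINT x:?U|lambda_hat x0. f x)"
    unfolding density_mass_def
    by (rule lebesgue_integral_countable_add[symmetric])
       (use Z_sets disjoint_Z set_integrable_lambda_hat[OF f(1) U] in auto)
  also have "\<dots> = (LINT x:{x0..1}|lambda_hat x0. f x)"
  proof (rule set_integral_cong_set)
    have "set_borel_measurable (lambda_hat x0) A f" if "A \<in> sets lebesgue" "A \<subseteq> {x0..1}" for A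
      using set_integrable_lambda_hat[OF f(1) that]
      unfolding set_integrable_def set_borel_measurable_def by (rule borel_measurable_integrable)
    then show "set_borel_measurable (lambda_hat x0) {x0..1} f" "set_borel_measurable (lambda_hat x0) ?U f"
      using U by auto
    have "{x0..1} - ?U \<in> null_sets lebesgue"
      by (intro null_sets_completionI countable_imp_null_set_lborel countable_diff_Z)
    then have "AE x in lebesgue. x \<notin> {x0..1} - ?U" by (rule AE_not_in)
    then show "AE x in lambda_hat x0. (x \<in> {x0..1}) = (x \<in> ?U)"
      unfolding AE_lambda_hat_iff by eventually_elim auto
  qed
  also have "\<dots> = 1" using f(2) by (simp add: is_density_def)
  finally show ?thesis .
qed

section \<open>Mean return times and the normalizing constants\<close>

abbreviation mean_return :: "(real \<Rightarrow> real) \<Rightarrow> real" where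
  "mean_return f \<equiv> \<Sum>k. real (Suc k) * density_mass x0 f (Z T x0 (Suc k))"

text \<open>Stated for signed functions because it is applied to the difference of two densities as
  well as to densities.\<close>

lemma abs_return_mass_le:
  assumes f: "continuous_on {x0..1} f" and B: "\<And>x. x \<in> {x0..1} \<Longrightarrow> \<bar>f x\<bar> \<le> B"
  shows "\<bar>real (Suc k) * density_mass x0 f (Z T x0 (Suc k))\<bar> \<le> B * weighted_return k"
proof -
  have "\<bar>density_mass x0 f (Z T x0 (Suc k))\<bar> \<le> B * measure (lambda_hat x0) (Z T x0 (Suc k))"
    using density_mass_le[OF f Z_sets Z_subset] B Z_subset by blast
  from mult_left_mono[OF this, of "real (Suc k)"] show ?thesis
    by (simp add: abs_mult mult_ac)
qed

lemma
  assumes f: "continuous_on {x0..1} f" and B: "\<And>x. x \<in> {x0..1} \<Longrightarrow> \<bar>f x\<bar> \<le> B"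
  shows summable_return_mass: "summable (\<lambda>k. real (Suc k) * density_mass x0 f (Z T x0 (Suc k)))"
    and abs_mean_return_le: "\<bar>mean_return f\<bar> \<le> C3 \<alpha> x0 \<beta> * B"
proof -
  let ?a = "\<lambda>k. real (Suc k) * density_mass x0 f (Z T x0 (Suc k))"
  have sm: "summable (\<lambda>k. B * weighted_return k)"
    by (intro summable_mult summable_weighted_return)
  have abs: "summable (\<lambda>k. \<bar>?a k\<bar>)"
    by (rule summable_comparison_test_ev[OF _ sm])
       (use abs_return_mass_le[OF assms] in auto)
  then show "summable ?a" by (rule summable_rabs_cancel)
  have "\<bar>mean_return f\<bar> \<le> (\<Sum>k. \<bar>?a k\<bar>)" by (rule summable_rabs[OF abs])
  also have "\<dots> \<le> (\<Sum>k. B * weighted_return k)"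
    by (intro suminf_le abs sm abs_return_mass_le assms)
  also have "\<dots> = B * (\<Sum>k. weighted_return k)"
    by (rule suminf_mult[OF summable_weighted_return])
  also have "\<dots> \<le> B * C3 \<alpha> x0 \<beta>"
    using B[of x0] x0 by (intro mult_left_mono suminf_weighted_return_le) auto
  finally show "\<bar>mean_return f\<bar> \<le> C3 \<alpha> x0 \<beta> * B" by (simp add: mult.commute)
qed

lemma mean_return_ge_1:
  assumes f: "continuous_on {x0..1} f" "is_density x0 f"
  shows "1 \<le> mean_return f"
proof -
  obtain B where B: "\<And>x. x \<in> {x0..1} \<Longrightarrow> \<bar>f x\<bar> \<le> B"
    using continuous_on_Icc_bounded[OF f(1)] by blast
  let ?m = "\<lambda>k. density_mass x0 f (Z T x0 (Suc k))"
  have m: "0 \<le> ?m k" for k using density_mass_nonneg[OF f(2) Z_subset] .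
  have le: "?m k \<le> real (Suc k) * ?m k" for k
    using mult_right_mono[of 1 "real (Suc k)" "?m k"] m[of k] by simp
  have s: "summable (\<lambda>k. real (Suc k) * ?m k)" by (rule summable_return_mass[OF f(1) B])
  have "summable ?m"
    by (rule summable_comparison_test_ev[OF _ s]) (use le m in auto)
  from suminf_le[OF le this s] show ?thesis
    unfolding suminf_density_mass[OF f] .
qed

lemma mean_return_diff:
  assumes f: "continuous_on {x0..1} f" and f': "continuous_on {x0..1} f'"
  shows "mean_return f - mean_return f' = mean_return (\<lambda>x. f x - f' x)"
proof -
  obtain B where B: "\<And>x. x \<in> {x0..1} \<Longrightarrow> \<bar>f x\<bar> \<le> B"
    using continuous_on_Icc_bounded[OF f] by blast
  obtain B' where B': "\<And>x. x \<in> {x0..1} \<Longrightarrow> \<bar>f' x\<bar> \<le> B'"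
    using continuous_on_Icc_bounded[OF f'] by blast
  have "summable (\<lambda>k. real (Suc k) * density_mass x0 f (Z T x0 (Suc k)))"
    by (rule summable_return_mass[OF f B])
  moreover have "summable (\<lambda>k. real (Suc k) * density_mass x0 f' (Z T x0 (Suc k)))"
    by (rule summable_return_mass[OF f' B'])
  ultimately show ?thesis
    by (simp only: suminf_diff right_diff_distrib[symmetric] density_mass_diff[OF f f' Z_sets Z_subset])
qed

lemma
  assumes f: "continuous_on {x0..1} f" "is_density x0 f"
  shows c_tau_pos: "0 < c_tau T x0 f" and c_tau_le_1: "c_tau T x0 f \<le> 1"
  unfolding c_tau_def using mean_return_ge_1[OF f] by (auto simp: inverse_le_1_iff)

lemma c_tau_diff_le:
  assumes f: "continuous_on {x0..1} f" "is_density x0 f"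
    and f': "continuous_on {x0..1} f'" "is_density x0 f'"
    and e: "\<And>x. x \<in> {x0..1} \<Longrightarrow> \<bar>f x - f' x\<bar> \<le> e"
  shows "\<bar>c_tau T x0 f - c_tau T x0 f'\<bar> \<le> C3 \<alpha> x0 \<beta> * e"
proof -
  let ?c = "c_tau T x0"
  have A: "1 \<le> mean_return f" "1 \<le> mean_return f'"
    using mean_return_ge_1 f f' by auto
  \<comment> \<open>The difference of two reciprocals. Both reciprocals are at most 1, and by
    linearity the difference of the mean return times is that of \<open>f - f'\<close>.\<close>
  have "?c f - ?c f' = - (?c f * ?c f' * (mean_return f - mean_return f'))"
    unfolding c_tau_def using A by (simp add: field_simps)
  then have "\<bar>?c f - ?c f'\<bar> = (?c f * ?c f') * \<bar>mean_return f - mean_return f'\<bar>"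
    using c_tau_pos[OF f] c_tau_pos[OF f'] by (simp add: abs_mult)
  also have "\<dots> \<le> 1 * \<bar>mean_return f - mean_return f'\<bar>"
    using c_tau_pos[OF f] c_tau_pos[OF f'] c_tau_le_1[OF f] c_tau_le_1[OF f']
    by (intro mult_right_mono mult_le_one) auto
  also have "\<dots> \<le> C3 \<alpha> x0 \<beta> * e"
    unfolding mean_return_diff[OF f(1) f'(1)] mult_1
    by (intro abs_mean_return_le continuous_on_diff f f' e)
  finally show ?thesis .
qed

end

section \<open>Total variation\<close>

lemma total_variation_mono: "S \<subseteq> S' \<Longrightarrow> total_variation S f \<le> total_variation S' f"
  unfolding total_variation_def by (rule SUP_subset_mono) auto

lemma total_variation_cong:
  assumes "\<And>x. x \<in> S \<Longrightarrow> f x = f' x"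
  shows "total_variation S f = total_variation S f'"
  unfolding total_variation_def
proof (intro SUP_cong refl sum.cong)
  fix xs i assume xs: "xs \<in> {xs. sorted xs \<and> set xs \<subseteq> S}" "i \<in> {..<length xs - 1}"
  then have "xs ! i \<in> S" "xs ! Suc i \<in> S" by auto
  then show "ennreal \<bar>f (xs ! Suc i) - f (xs ! i)\<bar> = ennreal \<bar>f' (xs ! Suc i) - f' (xs ! i)\<bar>"
    using assms by simp
qed

lemma abs_diff_le_total_variation:
  assumes "x \<in> S" "y \<in> S"
  shows "ennreal \<bar>f x - f y\<bar> \<le> total_variation S f"
proof -
  have *: "ennreal \<bar>f x - f y\<bar> \<le> total_variation S f" if "y \<le> x" "x \<in> S" "y \<in> S" for x y
    unfolding total_variation_def by (rule SUP_upper2[of "[y, x]"]) (use that in auto)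
  show ?thesis
    using *[of x y] *[of y x] assms by (cases "y \<le> x") (auto simp: abs_minus_commute)
qed

text \<open>Supplies finiteness of the variation, both as the premise of the Lasota-Yorke inequality
  and to move the term with \<gamma> to the other side.\<close>

lemma total_variation_lipschitz_le:
  assumes L: "L-lipschitz_on {a..b} f"
  shows "total_variation {a..b} f \<le> ennreal (L * (b - a))"
  unfolding total_variation_def
proof (rule SUP_least)
  fix xs :: "real list" assume "xs \<in> {xs. sorted xs \<and> set xs \<subseteq> {a..b}}"
  then have xs: "sorted xs" "set xs \<subseteq> {a..b}" by auto
  let ?n = "length xs - 1"
  have in_ab: "xs ! i \<in> {a..b}" if "i < length xs" for i
    using nth_mem[OF that] xs(2) by blast
  have "(\<Sum>i<?n. \<bar>f (xs ! Suc i) - f (xs ! i)\<bar>) \<le> (\<Sum>i<?n. L * (xs ! Suc i - xs ! i))"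
  proof (rule sum_mono)
    fix i assume "i \<in> {..<?n}"
    then have i: "Suc i < length xs" by auto
    show "\<bar>f (xs ! Suc i) - f (xs ! i)\<bar> \<le> L * (xs ! Suc i - xs ! i)"
      using lipschitz_onD[OF L in_ab[OF i] in_ab[of i]] i sorted_nth_mono[OF xs(1), of i "Suc i"]
      by (simp add: dist_real_def)
  qed
  also have "\<dots> = L * (xs ! ?n - xs ! 0)"
    by (simp add: sum_distrib_left[symmetric] sum_lessThan_telescope)
  also have "\<dots> \<le> L * (b - a)" if "xs \<noteq> []"
    using in_ab[of 0] in_ab[of ?n] that lipschitz_on_nonneg[OF L] by (intro mult_left_mono) auto
  finally have "(\<Sum>i<?n. \<bar>f (xs ! Suc i) - f (xs ! i)\<bar>) \<le> L * (b - a)" if "xs \<noteq> []"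
    using that by simp
  then show "(\<Sum>i<?n. ennreal \<bar>f (xs ! Suc i) - f (xs ! i)\<bar>) \<le> ennreal (L * (b - a))"
    by (cases "xs = []") (auto simp: sum_ennreal intro: ennreal_leI)
qed

text \<open>Cut the interval into cells of length at most \<delta>, choose one point of
  \<open>D\<close> in each open cell and send \<open>x\<close> to the choice of its cell.
  Monotonicity of \<phi> keeps a sorted list of points sorted.\<close>

lemma ex_mono_approximation:
  fixes a b \<delta> :: real
  assumes "a < b" "0 < \<delta>"
    and dense: "\<And>u v. a \<le> u \<Longrightarrow> u < v \<Longrightarrow> v \<le> b \<Longrightarrow> \<exists>d\<in>D. u < d \<and> d < v"
  obtains \<phi> where "mono_on {a..b} \<phi>" "\<And>x. x \<in> {a..b} \<Longrightarrow> \<phi> x \<in> D"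
    "\<And>x. x \<in> {a..b} \<Longrightarrow> \<phi> x \<in> {a..b}" "\<And>x. x \<in> {a..b} \<Longrightarrow> \<bar>\<phi> x - x\<bar> \<le> \<delta>"
proof -
  obtain N :: nat where N: "(b - a) / \<delta> < real N"
    using reals_Archimedean2 by blast
  have N0: "0 < real N" using N assms by (smt (verit) divide_pos_pos)
  define r where "r = (b - a) / real N"
  have r: "0 < r" "r \<le> \<delta>" "real N * r = b - a"
    using N N0 assms by (auto simp: r_def field_simps)
  have "\<exists>d. d \<in> D \<and> a + real k * r < d \<and> d < a + real (Suc k) * r" if "k < N" for k
  proof -
    have "real (Suc k) * r \<le> real N * r" using that r by (intro mult_right_mono) auto
    then show ?thesis
      using dense[of "a + real k * r" "a + real (Suc k) * r"] r by (auto simp: algebra_simps)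
  qed
  then obtain p where p: "\<And>k. k < N \<Longrightarrow> p k \<in> D \<and> a + real k * r < p k \<and> p k < a + real (Suc k) * r"
    by metis
  \<comment> \<open>The index of the cell containing \<open>x\<close>; the minimum puts the right
    endpoint \<open>b\<close> into the last cell.\<close>
  define \<kappa> where "\<kappa> x = min (nat \<lfloor>(x - a) / r\<rfloor>) (N - 1)" for x
  have \<kappa>: "\<kappa> x < N" "a + real (\<kappa> x) * r \<le> x" "x \<le> a + real (Suc (\<kappa> x)) * r" if x: "x \<in> {a..b}" for x
  proof -
    let ?q = "(x - a) / r"
    have q: "0 \<le> ?q" "?q \<le> real N" using x r by (auto simp: divide_le_eq)
    define k where "k = nat \<lfloor>?q\<rfloor>"
    have k: "real k \<le> ?q" "?q < real k + 1"
      unfolding k_def using q by linarith+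
    have \<kappa>: "\<kappa> x = min k (N - 1)" by (simp add: \<kappa>_def k_def)
    show "\<kappa> x < N" using N0 by (auto simp: \<kappa>)
    have "real (\<kappa> x) \<le> ?q" using k by (auto simp: \<kappa> min_def)
    then show "a + real (\<kappa> x) * r \<le> x" using r by (simp add: pos_le_divide_eq)
    have "?q \<le> real (Suc (\<kappa> x))" using k q N0 by (auto simp: \<kappa> min_def of_nat_diff)
    then show "x \<le> a + real (Suc (\<kappa> x)) * r" using r by (simp add: pos_divide_le_eq)
  qed
  have p_mono: "p i \<le> p j" if "i \<le> j" "j < N" for i j
  proof (cases "i = j")
    case False
    then have "real (Suc i) * r \<le> real j * r" using that r by (intro mult_right_mono) auto
    then show ?thesis using p[of i] p[of j] that False by auto
  qed simp
  show ?thesis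
  proof (rule that[of "\<lambda>x. p (\<kappa> x)"])
    show "mono_on {a..b} (\<lambda>x. p (\<kappa> x))"
    proof (rule mono_onI)
      fix x y assume xy: "x \<in> {a..b}" "y \<in> {a..b}" "x \<le> y"
      have "\<kappa> x \<le> \<kappa> y"
        using xy r unfolding \<kappa>_def
        by (intro min.mono nat_mono floor_mono divide_right_mono) auto
      then show "p (\<kappa> x) \<le> p (\<kappa> y)" using \<kappa>(1)[OF xy(2)] by (rule p_mono)
    qed
    fix x assume x: "x \<in> {a..b}"
    note k = \<kappa>[OF x] p[OF \<kappa>(1)[OF x]]
    show "p (\<kappa> x) \<in> D" using k by simp
    have "real (Suc (\<kappa> x)) * r \<le> real N * r"
      using k(1) r by (intro mult_right_mono) auto
    moreover have "0 \<le> real (\<kappa> x) * r" using r by simp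
    ultimately show "p (\<kappa> x) \<in> {a..b}" using k(4) r(3) by auto
    show "\<bar>p (\<kappa> x) - x\<bar> \<le> \<delta>" using k r by (auto simp: abs_le_iff algebra_simps)
  qed
qed

text \<open>Moving every point of a sorted list into \<open>D\<close> by at most \<delta> changes
  each increment of a Lipschitz function by at most \<open>2 * (L * \<delta>)\<close>, and the list
  has finitely many increments.\<close>

lemma total_variation_dense:
  assumes "a < b" and L: "L-lipschitz_on {a..b} f"
    and dense: "\<And>u v. a \<le> u \<Longrightarrow> u < v \<Longrightarrow> v \<le> b \<Longrightarrow> \<exists>d\<in>D. u < d \<and> d < v"
  shows "total_variation {a..b} f \<le> total_variation D f"
proof -
  have "(\<Sum>i<length xs - 1. ennreal \<bar>f (xs ! Suc i) - f (xs ! i)\<bar>) \<le> total_variation D f"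
    if xs: "sorted xs" "set xs \<subseteq> {a..b}" for xs
  proof (rule ennreal_le_epsilon)
    fix e :: real assume e: "0 < e"
    let ?n = "length xs - 1"
    have L0: "0 \<le> L" by (rule lipschitz_on_nonneg[OF L])
    \<comment> \<open>Chosen so that the \<open>?n\<close> errors add up to at most
      \<open>e\<close>; \<open>L + 1\<close> and \<open>?n + 1\<close> keep the denominator
      positive.\<close>
    define \<delta> where "\<delta> = e / (2 * (L + 1) * (real ?n + 1))"
    have \<delta>: "0 < \<delta>" using e L0 by (simp add: \<delta>_def)
    obtain \<phi> where \<phi>: "mono_on {a..b} \<phi>" "\<And>x. x \<in> {a..b} \<Longrightarrow> \<phi> x \<in> D"
      "\<And>x. x \<in> {a..b} \<Longrightarrow> \<phi> x \<in> {a..b}" "\<And>x. x \<in> {a..b} \<Longrightarrow> \<bar>\<phi> x - x\<bar> \<le> \<delta>"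
      using ex_mono_approximation[OF \<open>a < b\<close> \<delta> dense] by blast
    have close: "\<bar>f (\<phi> x) - f x\<bar> \<le> L * \<delta>" if "x \<in> {a..b}" for x
    proof -
      have "\<bar>f (\<phi> x) - f x\<bar> \<le> L * \<bar>\<phi> x - x\<bar>"
        using lipschitz_onD[OF L \<phi>(3)[OF that] that] by (simp add: dist_real_def)
      also have "\<dots> \<le> L * \<delta>" using \<phi>(4)[OF that] L0 by (rule mult_left_mono)
      finally show ?thesis .
    qed
    let ?ys = "map \<phi> xs"
    have "(\<Sum>i<?n. \<bar>f (xs ! Suc i) - f (xs ! i)\<bar>)
        \<le> (\<Sum>i<?n. \<bar>f (?ys ! Suc i) - f (?ys ! i)\<bar> + 2 * (L * \<delta>))"
    proof (rule sum_mono)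
      fix i assume "i \<in> {..<?n}"
      then have i: "Suc i < length xs" by auto
      then have "xs ! i \<in> {a..b}" "xs ! Suc i \<in> {a..b}"
        using xs(2) nth_mem[of i xs] nth_mem[of "Suc i" xs] Suc_lessD by blast+
      from close[OF this(1)] close[OF this(2)]
      show "\<bar>f (xs ! Suc i) - f (xs ! i)\<bar> \<le> \<bar>f (?ys ! Suc i) - f (?ys ! i)\<bar> + 2 * (L * \<delta>)"
        using i by simp
    qed
    also have "\<dots> = (\<Sum>i<?n. \<bar>f (?ys ! Suc i) - f (?ys ! i)\<bar>) + real ?n * (2 * (L * \<delta>))"
      by (simp add: sum.distrib)
    also have "real ?n * (2 * (L * \<delta>)) \<le> (real ?n + 1) * (2 * ((L + 1) * \<delta>))"
      using L0 \<delta> by (intro mult_mono mult_left_mono) auto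
    also have "\<dots> = e" using L0 unfolding \<delta>_def by (simp add: divide_simps)
    finally have "ennreal (\<Sum>i<?n. \<bar>f (xs ! Suc i) - f (xs ! i)\<bar>)
        \<le> ennreal ((\<Sum>i<?n. \<bar>f (?ys ! Suc i) - f (?ys ! i)\<bar>) + e)"
      by (intro ennreal_leI) simp
    also have "\<dots> = ennreal (\<Sum>i<?n. \<bar>f (?ys ! Suc i) - f (?ys ! i)\<bar>) + ennreal e"
      using e by (intro ennreal_plus sum_nonneg) auto
    also have "ennreal (\<Sum>i<?n. \<bar>f (?ys ! Suc i) - f (?ys ! i)\<bar>)
        = (\<Sum>i<length ?ys - 1. ennreal \<bar>f (?ys ! Suc i) - f (?ys ! i)\<bar>)"
      by (simp only: length_map) (rule sum_ennreal[symmetric], simp)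
    also have "\<dots> \<le> total_variation D f"
    proof -
      have "sorted ?ys"
        by (rule sorted_map_mono[OF xs(1)]) (rule monotone_on_subset[OF \<phi>(1) xs(2)])
      moreover have "set ?ys \<subseteq> D" using \<phi>(2) xs(2) by auto
      ultimately show ?thesis
        unfolding total_variation_def by (intro SUP_upper) simp
    qed
    finally show "(\<Sum>i<?n. ennreal \<bar>f (xs ! Suc i) - f (xs ! i)\<bar>) \<le> total_variation D f + ennreal e"
      by (simp add: sum_ennreal)
  qed
  then show ?thesis
    unfolding total_variation_def[of "{a..b}"] by (intro SUP_least) auto
qed

lemma sup_norm_ge:
  assumes "continuous_on {x0..1} f" "x \<in> {x0..1}"
  shows "\<bar>f x\<bar> \<le> sup_norm x0 f"
  unfolding sup_norm_def
proof (rule cSUP_upper[OF assms(2)])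
  have "compact ((\<lambda>x. \<bar>f x\<bar>) ` {x0..1})"
    by (intro compact_continuous_image continuous_intros assms) simp
  then show "bdd_above ((\<lambda>x. \<bar>f x\<bar>) ` {x0..1})"
    by (intro bounded_imp_bdd_above compact_imp_bounded)
qed

text \<open>A fixed point of the discretized operator is a finite combination of hat
  functions.\<close>

lemma discr_inv_density_continuous:
  assumes "discr_inv_density T x0 m f"
  shows "continuous_on {x0..1} f"
proof -
  have "continuous_on {x0..1} (discr_op T x0 m f)"
    unfolding discr_op_def Q_def by (intro continuous_intros continuous_on_hat)
  then show ?thesis
    by (rule continuous_on_eq) (use assms in \<open>auto simp: discr_inv_density_def\<close>)
qed

section \<open>Comparison of the densities\<close>

context neutral_map
begin

text \<open>A null set contains no interval. The points are sought in the open interval because the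
  Lasota-Yorke inequality bounds the variation of the image only there.\<close>

lemma AE_lambda_hat_dense:
  assumes P: "AE x in lambda_hat x0. P x" and uv: "x0 \<le> u" "u < v" "v \<le> 1"
  shows "\<exists>d\<in>{x \<in> {x0<..<1}. P x}. u < d \<and> d < v"
proof (rule ccontr)
  assume *: "\<not> ?thesis"
  have "AE x in lebesgue. x \<in> {x0..1} \<longrightarrow> P x" using P by (simp only: AE_lambda_hat_iff)
  then obtain N where N: "{x \<in> space lebesgue. \<not> (x \<in> {x0..1} \<longrightarrow> P x)} \<subseteq> N" "N \<in> null_sets lebesgue"
    unfolding eventually_ae_filter by blast
  have "{u<..<v} \<subseteq> {x \<in> space lebesgue. \<not> (x \<in> {x0..1} \<longrightarrow> P x)}"
    using * uv by auto
  with N(1) have "{u<..<v} \<subseteq> N" by blast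
  then have "negligible {u<..<v}"
    using N(2) by (meson negligible_iff_null_sets negligible_subset)
  then show False using open_not_negligible[of "{u<..<v}"] uv by simp
qed

text \<open>The density has mass 1 for the normalized measure, whereas the norm is taken with
  respect to Lebesgue measure.\<close>

lemma L1_norm_density:
  assumes f: "continuous_on {x0..1} f" "is_density x0 f"
  shows "L1_norm x0 f = 1 - x0"
proof -
  have "(\<lambda>x. indicator {x0..1} x *\<^sub>R f x) \<in> borel_measurable borel"
    by (rule borel_measurable_continuous_on_indicator) (use f in auto)
  then have m: "(\<lambda>x. indicator {x0..1} x *\<^sub>R f x) \<in> borel_measurable lebesgue"
    by (intro measurable_completion) simp
  have "1 = (LINT x|lambda_hat x0. indicator {x0..1} x *\<^sub>R f x)"
    using f(2) by (simp add: is_density_def set_lebesgue_integral_def)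
  also have "\<dots> = (LINT x|lebesgue. (indicator {x0..1} x / (1 - x0)) *\<^sub>R (indicator {x0..1} x *\<^sub>R f x))"
    unfolding lambda_hat_eq_density
    by (intro integral_density m borel_measurable_divide borel_measurable_indicator)
       (use x0 in auto)
  also have "\<dots> = (LINT x|lebesgue. (indicator {x0..1} x *\<^sub>R \<bar>f x\<bar>) / (1 - x0))"
    using f(2) by (intro Bochner_Integration.integral_cong) (auto simp: is_density_def indicator_def)
  also have "\<dots> = L1_norm x0 f / (1 - x0)"
    unfolding L1_norm_def set_lebesgue_integral_def by simp
  finally show ?thesis using x0 by (simp add: field_simps)
qed

lemma density_le_variation:
  assumes f: "continuous_on {x0..1} f" "is_density x0 f"
    and v: "total_variation {x0..1} f \<le> ennreal v" "0 \<le> v" and x: "x \<in> {x0..1}"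
  shows "f x \<le> 1 + v"
proof -
  have le: "f x - v \<le> f y" if "y \<in> {x0..1}" for y
    using order_trans[OF abs_diff_le_total_variation[OF x that] v(1)] v(2) by simp
  interpret finite_measure "lambda_hat x0" by (rule finite_measure_lambda_hat)
  have "(f x - v) * measure (lambda_hat x0) {x0..1} = (LINT y:{x0..1}|lambda_hat x0. f x - v)"
    by (simp add: set_lebesgue_integral_def)
  also have "\<dots> \<le> (LINT y:{x0..1}|lambda_hat x0. f y)"
    by (intro set_integral_mono set_integrable_lambda_hat f continuous_on_const le) auto
  also have "\<dots> = 1" using f(2) by (simp add: is_density_def)
  finally show ?thesis using x0 by (simp add: measure_lambda_hat)
qed

text \<open>One point of the domain is enough to conclude \<open>0 \<le> \<gamma>\<close> from the
  bound on the inverse derivative. The witness is the second-branch preimage of the midpoint of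
  \<open>{x0<..<1}\<close>.\<close>

lemma induced_dom_nonempty: "induced_dom T x0 \<noteq> {}"
proof -
  have "(1 + x0) / 2 \<in> {0<..<1}" using x0 by auto
  from h_props[OF this] have "h ((1 + x0) / 2) \<in> Z T x0 1"
    using x0 by (auto simp: Z_def W_def)
  then show ?thesis unfolding induced_dom_def by auto
qed

lemma induced_inv_density_le:
  assumes f: "induced_inv_density T x0 f" and "lasota_yorke T x0 \<gamma> C"
    and \<gamma>: "\<gamma> < 1" "\<forall>x\<in>induced_dom T x0. 1 / \<bar>deriv (induced_map T x0) x\<bar> \<le> \<gamma>"
    and "0 < C" and x: "x \<in> {x0..1}"
  shows "f x \<le> C / (1 - \<gamma>) + 1 / (1 - x0)"
proof -
  obtain L where dens: "is_density x0 f" and L: "L-lipschitz_on {x0..1} f"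
    and inv: "AE x in lambda_hat x0. transfer_op T x0 f x = f x"
    using f unfolding induced_inv_density_def by blast
  have cont: "continuous_on {x0..1} f" by (rule lipschitz_on_continuous_on[OF L])
  obtain y where "y \<in> induced_dom T x0" using induced_dom_nonempty by blast
  then have "1 / \<bar>deriv (induced_map T x0) y\<bar> \<le> \<gamma>" using \<gamma>(2) by blast
  moreover have "0 \<le> 1 / \<bar>deriv (induced_map T x0) y\<bar>" by simp
  ultimately have \<gamma>0: "0 \<le> \<gamma>" by linarith
  have fin: "total_variation {x0..1} f < \<infinity>"
    using total_variation_lipschitz_le[OF L] by (rule order.strict_trans1) simp
  then obtain v where v: "total_variation {x0..1} f = ennreal v" "0 \<le> v"
    by (cases "total_variation {x0..1} f") auto
  define D where "D = {x \<in> {x0<..<1}. transfer_op T x0 f x = f x}"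
  \<comment> \<open>\<open>transfer_op T x0 f\<close> and \<open>f\<close> agree only almost everywhere, but \<open>f\<close> is continuous, so the
    variation of \<open>f\<close> is already attained on the dense set of agreement.\<close>
  have "ennreal v \<le> total_variation D f"
    unfolding v(1)[symmetric] D_def
    using x0 L AE_lambda_hat_dense[OF inv] by (intro total_variation_dense) auto
  also have "\<dots> = total_variation D (transfer_op T x0 f)"
    by (rule total_variation_cong) (simp add: D_def)
  also have "\<dots> \<le> total_variation {x0<..<1} (transfer_op T x0 f)"
    by (rule total_variation_mono) (auto simp: D_def)
  also have "\<dots> \<le> ennreal \<gamma> * ennreal v + ennreal (C * (1 - x0))"
    using \<open>lasota_yorke T x0 \<gamma> C\<close> fin
    by (simp add: lasota_yorke_def bounded_variation_on_def v(1)[symmetric] L1_norm_density[OF cont dens, symmetric])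
  also have "\<dots> = ennreal (\<gamma> * v + C * (1 - x0))"
    using \<gamma>0 v(2) \<open>0 < C\<close> x0 by (simp add: ennreal_mult ennreal_plus)
  finally have "v \<le> \<gamma> * v + C * (1 - x0)"
    using \<gamma>0 v(2) \<open>0 < C\<close> x0 by (subst (asm) ennreal_le_iff) auto
  also have "\<dots> \<le> \<gamma> * v + C" using \<open>0 < C\<close> x0 by simp
  finally have "v \<le> C / (1 - \<gamma>)" using \<gamma>(1) by (simp add: field_simps)
  moreover have "1 \<le> 1 / (1 - x0)" using x0 by (simp add: field_simps)
  moreover have "f x \<le> 1 + v"
    by (rule density_le_variation[OF cont dens _ v(2) x]) (simp add: v(1))
  ultimately show ?thesis by linarith
qed

lemma normalized_density_diff_le:
  assumes f: "continuous_on {x0..1} f" "is_density x0 f"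
    and f': "continuous_on {x0..1} f'" "is_density x0 f'"
    and e: "\<And>x. x \<in> {x0..1} \<Longrightarrow> \<bar>f x - f' x\<bar> \<le> e"
    and B: "\<And>x. x \<in> {x0..1} \<Longrightarrow> f x \<le> B" and x: "x \<in> {x0..1}"
  shows "\<bar>c_tau T x0 f * f x - c_tau T x0 f' * f' x\<bar> \<le> (1 + C3 \<alpha> x0 \<beta> * B) * e"
proof -
  let ?c = "c_tau T x0"
  have "\<bar>f x\<bar> \<le> B" using B[OF x] f(2) x by (auto simp: is_density_def)
  have "?c f * f x - ?c f' * f' x = ?c f' * (f x - f' x) + (?c f - ?c f') * f x"
    by (simp add: algebra_simps)
  then have "\<bar>?c f * f x - ?c f' * f' x\<bar> \<le> ?c f' * \<bar>f x - f' x\<bar> + \<bar>?c f - ?c f'\<bar> * \<bar>f x\<bar>"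
    using c_tau_pos[OF f'] by (metis abs_mult abs_of_pos abs_triangle_ineq)
  also have "\<dots> \<le> 1 * e + (C3 \<alpha> x0 \<beta> * e) * B"
    using c_tau_le_1[OF f'] c_tau_pos[OF f'] e[OF x] c_tau_diff_le[OF f f' e] \<open>\<bar>f x\<bar> \<le> B\<close> C3_nonneg
    by (intro add_mono mult_mono) auto
  finally show ?thesis by (simp add: algebra_simps)
qed

text \<open>The extension depends only on the products of normalizing constant and density at points
  of \<open>{x0..1}\<close>, so one uniform bound \<open>E\<close> serves everywhere. In the
  bracket, 1 covers \<open>x\<close> in \<open>{x0..1}\<close>, where
  \<open>x powr (1 + \<alpha>)\<close> is at most 1; the other summands bound the sum of the
  weights.\<close>

lemma extend_density_diff_le:
  assumes f: "continuous_on {x0..1} f" and f': "continuous_on {x0..1} f'"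
    and E: "\<And>y. y \<in> {x0..1} \<Longrightarrow> \<bar>c_tau T x0 f * f y - c_tau T x0 f' * f' y\<bar> \<le> E"
    and x: "x \<in> {0<..1}"
  shows "\<bar>extend_density T x0 f x - extend_density T x0 f' x\<bar>
    \<le> E * (1 + x0 powr (1 + \<alpha>) / \<beta> + M_const \<alpha> x0 \<beta> \<delta>0 * (1 + \<alpha>)) / x powr (1 + \<alpha>)"
proof -
  let ?K = "x0 powr (1 + \<alpha>) / \<beta> + M_const \<alpha> x0 \<beta> \<delta>0 * (1 + \<alpha>)"
  let ?p = "x powr (1 + \<alpha>)"
  have E0: "0 \<le> E" using E[of x0] x0 by auto
  have K0: "0 \<le> ?K" using alpha beta by (simp add: M_const_def)
  have p: "0 < ?p" "?p \<le> 1" using x alpha by (auto intro: powr_le1)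
  show ?thesis
  proof (cases "x \<in> {x0..1}")
    case True
    have "E * ?p \<le> E * (1 + ?K)" using E0 K0 p by (intro mult_left_mono) auto
    then have "E \<le> E * (1 + ?K) / ?p" using p by (simp add: pos_le_divide_eq)
    then show ?thesis using E[OF True] True by (simp add: extend_density_def add.assoc)
  next
    case False
    then have x': "x \<in> {0<..<x0}" using x by auto
    define y where "y n = h ((g ^^ n) x)" for n
    have y: "y n \<in> {x0..1}" for n
      using h_props(1)[of "(g ^^ n) x"] gpow_in[of x n] x' x0 unfolding y_def by auto
    note sw = summable_weight[OF x']
    have sm: "summable (\<lambda>n. k y n * weight x n)" if "\<And>n. \<bar>k y n\<bar> \<le> B" for k :: "_ \<Rightarrow> nat \<Rightarrow> real" and B
    proof (rule summable_comparison_test_ev[OF always_eventually summable_mult[OF sw, of B]], rule allI)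
      show "norm (k y n * weight x n) \<le> B * weight x n" for n
        using mult_right_mono[OF that weight_nonneg] by (simp add: abs_mult weight_nonneg)
    qed
    have sf: "summable (\<lambda>n. k (y n) * weight x n)" if k: "continuous_on {x0..1} k" for k
    proof -
      obtain B where "\<And>x. x \<in> {x0..1} \<Longrightarrow> \<bar>k x\<bar> \<le> B"
        using continuous_on_Icc_bounded[OF k] by blast
      then show ?thesis using sm[of "\<lambda>y n. k (y n)" B] y by blast
    qed
    have ext: "extend_density T x0 k x = (\<Sum>n. c_tau T x0 k * k (y n) * weight x n)"
      if k: "continuous_on {x0..1} k" for k
    proof -
      have "extend_density T x0 k x = c_tau T x0 k * (\<Sum>n. k (y n) * weight x n)"
        using False by (simp only: extend_density_def if_False Let_def y_def weight_def) simp
      also have "\<dots> = (\<Sum>n. c_tau T x0 k * (k (y n) * weight x n))"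
        by (rule suminf_mult[symmetric, OF sf[OF k]])
      finally show ?thesis by (simp only: mult.assoc)
    qed
    let ?d = "\<lambda>n. c_tau T x0 f * f (y n) - c_tau T x0 f' * f' (y n)"
    have d: "\<bar>?d n * weight x n\<bar> \<le> E * weight x n" for n
      using E[OF y] weight_nonneg[of x n] by (simp add: abs_mult mult_right_mono)
    have sE: "summable (\<lambda>n. E * weight x n)" by (rule summable_mult[OF sw])
    have sabs: "summable (\<lambda>n. \<bar>?d n * weight x n\<bar>)"
      by (rule summable_comparison_test_ev[OF _ sE]) (use d in auto)
    have "extend_density T x0 f x - extend_density T x0 f' x = (\<Sum>n. ?d n * weight x n)"
      unfolding ext[OF f] ext[OF f']
      using summable_mult[OF sf[OF f], of "c_tau T x0 f"] summable_mult[OF sf[OF f'], of "c_tau T x0 f'"]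
      by (subst suminf_diff) (simp_all only: mult.assoc left_diff_distrib)
    then have "\<bar>extend_density T x0 f x - extend_density T x0 f' x\<bar> \<le> (\<Sum>n. \<bar>?d n * weight x n\<bar>)"
      using summable_rabs[OF sabs] by simp
    also have "\<dots> \<le> (\<Sum>n. E * weight x n)"
      by (rule suminf_le[OF d sabs sE])
    also have "\<dots> = E * (\<Sum>n. weight x n)" by (rule suminf_mult[OF sw])
    also have "\<dots> \<le> E * (?K / ?p)"
      by (rule mult_left_mono[OF suminf_weight_le[OF x'] E0])
    also have "\<dots> \<le> E * ((1 + ?K) / ?p)"
      using E0 p by (intro mult_left_mono divide_right_mono) auto
    finally show ?thesis by (simp add: add.assoc)
  qed
qed

end

theorem corollary3p2:
  fixes T T1 \<delta>0 \<delta>1 f_hat :: "real \<Rightarrow> real"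
    and f_hat_m :: "nat \<Rightarrow> real \<Rightarrow> real"
    and \<alpha> x0 \<beta> \<gamma> C_LY C_hat :: real
    and m0 :: nat
  assumes "neutral_map T T1 \<alpha> x0 \<beta> \<delta>0 \<delta>1"
    and "induced_inv_density T x0 f_hat"
    and "\<forall>m\<ge>1. discr_inv_density T x0 m (f_hat_m m)"
    and "\<gamma> < 1" and "C_LY > 0" and "C_hat > 0"
    and "\<forall>x\<in>induced_dom T x0. 1 / \<bar>deriv (induced_map T x0) x\<bar> \<le> \<gamma>"
    and "lasota_yorke T x0 \<gamma> C_LY"
    and "m0 \<ge> 1"
    and "\<forall>m\<ge>m0. sup_norm x0 (\<lambda>x. f_hat x - f_hat_m m x) \<le> C_hat * (ln (real m) / real m)"
  shows "\<forall>x\<in>{0<..1}. \<forall>m\<ge>m0.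
           \<bar>extend_density T x0 f_hat x - extend_density T x0 (f_hat_m m) x\<bar>
             \<le> C_star \<alpha> x0 \<beta> \<delta>0 \<gamma> C_LY C_hat / x powr (1 + \<alpha>) * (ln (real m) / real m)"
proof (intro ballI allI impI)
  interpret neutral_map T T1 \<alpha> x0 \<beta> \<delta>0 \<delta>1 by fact
  fix x m assume x: "x \<in> {0<..(1::real)}" and m: "m0 \<le> m"
  let ?e = "C_hat * (ln (real m) / real m)"
  have f: "continuous_on {x0..1} f_hat" "is_density x0 f_hat"
    using assms(2) by (auto simp: induced_inv_density_def intro: lipschitz_on_continuous_on)
  have "discr_inv_density T x0 m (f_hat_m m)" using assms(3,9) m by auto
  then have f': "continuous_on {x0..1} (f_hat_m m)" "is_density x0 (f_hat_m m)"
    by (auto intro: discr_inv_density_continuous simp: discr_inv_density_def)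
  have e: "\<bar>f_hat y - f_hat_m m y\<bar> \<le> ?e" if "y \<in> {x0..1}" for y
    using sup_norm_ge[OF continuous_on_diff[OF f(1) f'(1)] that] assms(10) m by force
  have B: "f_hat y \<le> C_LY / (1 - \<gamma>) + 1 / (1 - x0)" if "y \<in> {x0..1}" for y
    using induced_inv_density_le assms that by blast
  have "\<bar>c_tau T x0 f_hat * f_hat y - c_tau T x0 (f_hat_m m) * f_hat_m m y\<bar>
      \<le> C4 \<alpha> x0 \<beta> \<gamma> C_LY * ?e" if "y \<in> {x0..1}" for y
    unfolding C4_def by (rule normalized_density_diff_le[OF f f' e B that])
  from extend_density_diff_le[OF f(1) f'(1) this x]
  show "\<bar>extend_density T x0 f_hat x - extend_density T x0 (f_hat_m m) x\<bar>
      \<le> C_star \<alpha> x0 \<beta> \<delta>0 \<gamma> C_LY C_hat / x powr (1 + \<alpha>) * (ln (real m) / real m)"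
    by (simp add: C_star_def mult_ac)
qed

end
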